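(* Let $\mathcal{X}\subseteq\mathbb{R}$ be a connected set with nonempty interior, let $\sigma>0$ and $\varepsilon>0$ with $[0,\varepsilon]\subseteq\mathcal{X}$, and let $f:\mathcal{X}\to\mathbb{R}$ be given by $f(x)=-\sum_{n=1}^\infty a_nx^n$ for all $x\in\mathcal{X}$, with $\{a_n\}_{n\in\mathbb{N}}\subset\mathbb{R}$. Assume $f(0)=0$, $f(x)<0$ for all $x\in\mathcal{X}\setminus\{0\}$, and $\int_{\mathcal{X}}\frac{1}{|f(x)+p|}\,\mathrm{d}x<+\infty$ for every $p<0$. Let $m\in\mathbb{N}$ denote the index for which $a_n=0$ for every $n\in\{1,\dots,m-1\}$ and $a_m\neq0$. Let $Q=\operatorname{I}$ be the identity on $L^2(\mathcal{X})$, and for $p<0$ let $V_\infty$ be the time-asymptotic covariance operator of the solution of $\mathrm{d}u(x,t)=(f(x)+p)\,u(x,t)\,\mathrm{d}t+\sigma\,\mathrm{d}W(t)$. Let $g=\mathbbm{1}_{[0,\varepsilon]}$. Then, as $p\to0^-$: (i) if $m=1$, then $\langle V_\infty g,g\rangle=\Theta(-\log(-p))$; (ii) if $m>1$, then $\langle V_\infty g,g\rangle=\Theta\big((-p)^{-1+\frac1m}\big)$.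
   Context: $\mathbb{N}=\{1,2,3,\dots\}$. $L^2(\mathcal{X})$ is the real Hilbert space of square-integrable functions with usual scalar product $\langle\cdot,\cdot\rangle$, and $\mathbbm{1}_S$ is the indicator function of $S$. $\operatorname{T}_{h}$ denotes the multiplication operator $u\mapsto hu$ in $L^2(\mathcal{X})$. $W$ is a (generalized) $Q$-Wiener process with covariance operator $Q$. The covariance operator at time $t>0$ of the mild solution of the stochastic equation is $$V(t):=\sigma^2\int_0^t e^{\operatorname{T}_{f+p}s}\,Q\,e^{\operatorname{T}_{f+p}s}\,\mathrm{d}s,$$ and the time-asymptotic covariance operator is $V_\infty:=\lim_{t\to\infty}V(t)$ (it depends on $p<0$). Notation $\Theta$: for functions $b_1,b_2$ of $p<0$ that are positive for $p$ near $0$, $b_1=\Theta(b_2)$ as $p\to0^-$ means $\lim_{p\to0^-}\frac{b_1(p)}{b_2(p)}>0$ and $\lim_{p\to0^-}\frac{b_2(p)}{b_1(p)}>0$. *)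

theory Defs
  imports "HOL-Analysis.Analysis"
begin

section \<open>The real Hilbert space of square-integrable functions on the line\<close>

definition square_integrable :: "(real \<Rightarrow> real) \<Rightarrow> bool" where
  "square_integrable u \<longleftrightarrow> u \<in> borel_measurable lborel \<and> integrable lborel (\<lambda>x. (u x)\<^sup>2)"

definition L2_rel :: "(real \<Rightarrow> real) \<Rightarrow> (real \<Rightarrow> real) \<Rightarrow> bool" where
  "L2_rel u v \<longleftrightarrow> square_integrable u \<and> square_integrable v \<and> (AE x in lborel. u x = v x)"

lemma square_integrable_zero: "square_integrable (\<lambda>x. 0)"
  by (simp add: square_integrable_def)

lemma square_integrable_mult:
  assumes "square_integrable u" "square_integrable v"
  shows "integrable lborel (\<lambda>x. u x * v x)"
proof (rule Bochner_Integration.integrable_bound)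
  show "integrable lborel (\<lambda>x. (u x)\<^sup>2 + (v x)\<^sup>2)"
    using assms by (auto simp: square_integrable_def)
  show "(\<lambda>x. u x * v x) \<in> borel_measurable lborel"
    using assms by (auto simp: square_integrable_def)
  have "\<bar>a * b\<bar> \<le> a\<^sup>2 + b\<^sup>2" for a b :: real
  proof -
    have "2 * \<bar>a\<bar> * \<bar>b\<bar> \<le> a\<^sup>2 + b\<^sup>2"
      using sum_squares_bound[of "\<bar>a\<bar>" "\<bar>b\<bar>"] by simp
    moreover have "0 \<le> \<bar>a\<bar> * \<bar>b\<bar>" by simp
    ultimately show ?thesis by (simp only: abs_mult)
  qed
  then show "AE x in lborel. norm (u x * v x) \<le> norm ((u x)\<^sup>2 + (v x)\<^sup>2)"
    by (auto simp del: abs_mult)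
qed

lemma square_integrable_add:
  assumes "square_integrable u" "square_integrable v"
  shows "square_integrable (\<lambda>x. u x + v x)"
  using square_integrable_mult[OF assms] assms
  by (auto simp: square_integrable_def power2_sum mult.assoc)

lemma square_integrable_scale:
  assumes "square_integrable u"
  shows "square_integrable (\<lambda>x. c * u x)"
  using assms by (auto simp: square_integrable_def power_mult_distrib)

lemma square_integrable_uminus:
  assumes "square_integrable u"
  shows "square_integrable (\<lambda>x. - u x)"
  using square_integrable_scale[OF assms, of "-1"] by simp

lemma square_integrable_diff:
  assumes "square_integrable u" "square_integrable v"
  shows "square_integrable (\<lambda>x. u x - v x)"
  using square_integrable_add[OF assms(1) square_integrable_uminus[OF assms(2)]] by simp

quotient_type L2 = "real \<Rightarrow> real" / partial: L2_rel
  morphisms rep_L2 abs_L2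
proof (rule part_equivpI)
  show "\<exists>u. L2_rel u u"
    using square_integrable_zero by (auto simp: L2_rel_def)
  show "symp L2_rel" by (auto simp: symp_def L2_rel_def)
  show "transp L2_rel" by (auto simp: transp_def L2_rel_def)
qed

instantiation L2 :: real_vector
begin

lift_definition zero_L2 :: L2 is "\<lambda>x. 0"
  by (auto simp: L2_rel_def square_integrable_zero)

lift_definition plus_L2 :: "L2 \<Rightarrow> L2 \<Rightarrow> L2" is "\<lambda>u v x. u x + v x"
  by (auto simp: L2_rel_def square_integrable_add)

lift_definition uminus_L2 :: "L2 \<Rightarrow> L2" is "\<lambda>u x. - u x"
  by (auto simp: L2_rel_def square_integrable_uminus)

lift_definition minus_L2 :: "L2 \<Rightarrow> L2 \<Rightarrow> L2" is "\<lambda>u v x. u x - v x"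
  by (auto simp: L2_rel_def square_integrable_diff)

lift_definition scaleR_L2 :: "real \<Rightarrow> L2 \<Rightarrow> L2" is "\<lambda>c u x. c * u x"
  by (auto simp: L2_rel_def square_integrable_scale)

instance
proof
  fix u v w :: L2 and r s :: real
  show "u + v + w = u + (v + w)"
    by transfer (auto simp: L2_rel_def square_integrable_add add.assoc)
  show "u + v = v + u"
    by transfer (auto simp: L2_rel_def square_integrable_add add.commute)
  show "0 + u = u"
    by transfer (auto simp: L2_rel_def)
  show "- u + u = 0"
    by transfer (auto simp: L2_rel_def square_integrable_zero)
  show "u - v = u + - v"
    by transfer (auto simp: L2_rel_def square_integrable_diff)
  show "r *\<^sub>R (u + v) = r *\<^sub>R u + r *\<^sub>R v"
    by transfer (auto simp: L2_rel_def distrib_left intro!: square_integrable_add square_integrable_scale)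
  show "(r + s) *\<^sub>R u = r *\<^sub>R u + s *\<^sub>R u"
    by transfer (auto simp: L2_rel_def distrib_right intro!: square_integrable_add square_integrable_scale)
  show "r *\<^sub>R s *\<^sub>R u = (r * s) *\<^sub>R u"
    by transfer (auto simp: L2_rel_def mult.assoc
        intro!: square_integrable_scale square_integrable_scale[of _ "r * s", unfolded mult.assoc])
  show "1 *\<^sub>R u = u"
    by transfer (auto simp: L2_rel_def)
qed

end

instantiation L2 :: real_inner
begin

lift_definition inner_L2 :: "L2 \<Rightarrow> L2 \<Rightarrow> real" is "\<lambda>u v. LINT x|lborel. u x * v x"
  by (rule integral_cong_AE) (auto simp: L2_rel_def square_integrable_def)

definition norm_L2 :: "L2 \<Rightarrow> real" where "norm_L2 u = sqrt (inner u u)"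

definition dist_L2 :: "L2 \<Rightarrow> L2 \<Rightarrow> real" where "dist_L2 u v = norm (u - v)"

definition sgn_L2 :: "L2 \<Rightarrow> L2" where "sgn_L2 u = u /\<^sub>R norm u"

definition uniformity_L2 :: "(L2 \<times> L2) filter" where
  "uniformity_L2 = (INF e\<in>{0<..}. principal {(x, y). dist x y < e})"

definition open_L2 :: "L2 set \<Rightarrow> bool" where
  "open_L2 S = (\<forall>x\<in>S. \<forall>\<^sub>F (x', y) in uniformity. x' = x \<longrightarrow> y \<in> S)"

instance
proof
  fix u v w :: L2 and r s :: real
  show "dist u v = norm (u - v)" by (simp add: dist_L2_def)
  show "sgn u = u /\<^sub>R norm u" by (simp add: sgn_L2_def)
  show "uniformity = (INF e\<in>{0<..}. principal {(x :: L2, y). dist x y < e})"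
    by (simp add: uniformity_L2_def)
  show "open S = (\<forall>x\<in>S. \<forall>\<^sub>F (x', y) in uniformity. x' = x \<longrightarrow> y \<in> S)" for S :: "L2 set"
    by (simp add: open_L2_def)
  show "inner u v = inner v u"
    by transfer (simp add: mult.commute)
  show "inner (u + v) w = inner u w + inner v w"
    by transfer (simp add: L2_rel_def distrib_right square_integrable_mult)
  show "inner (r *\<^sub>R u) v = r * inner u v"
    by transfer (simp add: mult.assoc)
  show "0 \<le> inner u u"
    by transfer simp
  show "inner u u = 0 \<longleftrightarrow> u = 0"
  proof transfer
    fix u :: "real \<Rightarrow> real"
    assume "L2_rel u u"
    then have u: "square_integrable u" by (simp add: L2_rel_def)
    then have "integrable lborel (\<lambda>x. u x * u x)" by (rule square_integrable_mult[OF u])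
    then have "(LINT x|lborel. u x * u x) = 0 \<longleftrightarrow> (AE x in lborel. u x * u x = 0)"
      by (intro integral_nonneg_eq_0_iff_AE) auto
    then show "((LINT x|lborel. u x * u x) = 0) = L2_rel u (\<lambda>x. 0)"
      using u by (simp add: L2_rel_def square_integrable_zero)
  qed
  show "norm u = sqrt (inner u u)" by (simp add: norm_L2_def)
qed

end

lemma square_integrable_rep_L2: "square_integrable (rep_L2 u)"
  using Quotient3_rep_reflp[OF Quotient3_L2, of u] by (simp add: L2_rel_def)

lemma abs_rep_L2: "abs_L2 (rep_L2 u) = u"
  by (rule Quotient3_abs_rep[OF Quotient3_L2])

lemma abs_L2_eq_iff:
  assumes "square_integrable u" "square_integrable v"
  shows "abs_L2 u = abs_L2 v \<longleftrightarrow> (AE x in lborel. u x = v x)"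
  using Quotient3_rel[OF Quotient3_L2, of u v] assms by (auto simp: L2_rel_def)

lemma rep_abs_L2:
  assumes "square_integrable u"
  shows "AE x in lborel. rep_L2 (abs_L2 u) x = u x"
  using abs_L2_eq_iff[OF square_integrable_rep_L2[of "abs_L2 u"] assms] by (simp add: abs_rep_L2)

lemma diff_abs_L2:
  assumes "square_integrable u" "square_integrable v"
  shows "abs_L2 u - abs_L2 v = abs_L2 (\<lambda>x. u x - v x)"
  using assms by (intro minus_L2.abs_eq) (auto simp: L2_rel_def)

lemma norm_abs_L2:
  assumes "square_integrable u"
  shows "(norm (abs_L2 u))\<^sup>2 = (LINT x|lborel. (u x)\<^sup>2)"
  using assms unfolding power2_norm_eq_inner
  by (subst inner_L2.abs_eq) (auto simp: L2_rel_def power2_eq_square)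

lemma nn_integral_norm_L2:
  assumes "square_integrable u"
  shows "(\<integral>\<^sup>+x. ennreal ((u x)\<^sup>2) \<partial>lborel) = ennreal ((norm (abs_L2 u))\<^sup>2)"
  using assms unfolding norm_abs_L2[OF assms]
  by (intro nn_integral_eq_integral) (auto simp: square_integrable_def)

instance L2 :: banach
proof
  fix X :: "nat \<Rightarrow> L2"
  assume X: "Cauchy X"
  have "\<exists>N. \<forall>m\<ge>N. \<forall>n\<ge>N. norm (X m - X n) < (1/4)^k" for k
    using CauchyD[OF X, of "(1/4)^k"] by simp
  then obtain N where N: "\<And>k m n. m \<ge> N k \<Longrightarrow> n \<ge> N k \<Longrightarrow> norm (X m - X n) < (1/4)^k"
    by metis
  define r where "r = rec_nat (N 0) (\<lambda>k s. max (Suc s) (N (Suc k)))"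
  have r_Suc: "r (Suc k) = max (Suc (r k)) (N (Suc k))" for k by (simp add: r_def)
  have r: "strict_mono r" by (simp add: strict_mono_Suc_iff r_Suc less_max_iff_disj)
  have rN: "r k \<ge> N k" for k by (cases k) (simp_all add: r_def)
  have rr: "norm (X (r (Suc k)) - X (r k)) < (1/4)^k" for k
    by (rule N) (use rN[of k] r_Suc[of k] in auto)
  define v where "v k = rep_L2 (X (r k))" for k
  have v: "square_integrable (v k)" and abs_v: "abs_L2 (v k) = X (r k)" for k
    by (simp_all add: v_def square_integrable_rep_L2 abs_rep_L2)
  have v_meas [measurable]: "v k \<in> borel_measurable lborel" for k
    using v by (simp add: square_integrable_def)
  define d where "d k x = v (Suc k) x - v k x" for k x
  have d: "square_integrable (d k)" for k
    unfolding d_def by (intro square_integrable_diff v)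
  have d_meas [measurable]: "d k \<in> borel_measurable lborel" for k
    using d by (simp add: square_integrable_def)
  have "(\<integral>\<^sup>+x. (\<Sum>k. ennreal (4^k * (d k x)\<^sup>2)) \<partial>lborel) = (\<Sum>k. \<integral>\<^sup>+x. ennreal (4^k * (d k x)\<^sup>2) \<partial>lborel)"
    by (rule nn_integral_suminf) auto
  also have "\<dots> \<le> (\<Sum>k. ennreal ((1/4)^k))"
  proof (rule suminf_le)
    fix k
    have "(\<integral>\<^sup>+x. ennreal (4^k * (d k x)\<^sup>2) \<partial>lborel) = ennreal (4^k) * ennreal ((norm (abs_L2 (d k)))\<^sup>2)"
      by (simp add: ennreal_mult' nn_integral_cmult flip: nn_integral_norm_L2[OF d])
    also have "abs_L2 (d k) = X (r (Suc k)) - X (r k)"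
      unfolding d_def by (simp add: abs_v flip: diff_abs_L2[OF v v])
    also have "ennreal (4^k) * ennreal ((norm (X (r (Suc k)) - X (r k)))\<^sup>2)
                 \<le> ennreal (4^k) * ennreal (((1/4)^k)\<^sup>2)"
      by (intro mult_left_mono ennreal_leI power_mono less_imp_le[OF rr]) auto
    also have "\<dots> = ennreal ((1/4)^k)"
      by (simp add: power2_eq_square field_simps flip: ennreal_mult')
    finally show "(\<integral>\<^sup>+x. ennreal (4^k * (d k x)\<^sup>2) \<partial>lborel) \<le> ennreal ((1/4)^k)" .
  qed auto
  also have "\<dots> < \<infinity>"
    by (subst suminf_ennreal2) (auto intro: summable_geometric)
  finally have "AE x in lborel. (\<Sum>k. ennreal (4^k * (d k x)\<^sup>2)) \<noteq> \<infinity>"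
    by (intro nn_integral_PInf_AE) auto
  then have conv: "AE x in lborel. convergent (\<lambda>k. v k x)"
  proof eventually_elim
    case (elim x)
    then have "summable (\<lambda>k. 4^k * (d k x)\<^sup>2)"
      by (intro summable_suminf_not_top) auto
    then have "Bseq (\<lambda>k. 4^k * (d k x)\<^sup>2)"
      by (intro convergent_imp_Bseq) (use summable_LIMSEQ_zero convergent_def in blast)
    then obtain K where K: "K > 0" "\<And>k. norm (4^k * (d k x)\<^sup>2) \<le> K"
      by (auto simp: Bseq_def)
    have "norm (d k x) \<le> sqrt K * (1/2)^k" for k
    proof -
      have "(2^k * \<bar>d k x\<bar>)\<^sup>2 = 4^k * (d k x)\<^sup>2"
        by (simp add: power_mult_distrib flip: power_mult) (simp add: mult.commute[of k] power_mult)
      also have "\<dots> \<le> K" using K(2)[of k] by simp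
      finally have "2^k * \<bar>d k x\<bar> \<le> sqrt K" by (rule real_le_rsqrt)
      then show ?thesis by (simp add: field_simps power_divide)
    qed
    moreover have "summable (\<lambda>k. sqrt K * (1/2)^k)"
      by (intro summable_mult summable_geometric) simp
    ultimately have "summable (\<lambda>k. d k x)"
      by (metis summable_comparison_test')
    then have "convergent (\<lambda>n. v 0 x + (\<Sum>k<n. d k x))"
      by (intro convergent_add convergent_const) (simp add: summable_iff_convergent)
    moreover have "v 0 x + (\<Sum>k<n. d k x) = v n x" for n
      by (simp add: d_def sum_lessThan_telescope[of "\<lambda>k. v k x"])
    ultimately show "convergent (\<lambda>k. v k x)" by simp
  qed
  define u where "u x = lim (\<lambda>k. v k x)" for x
  have u_meas [measurable]: "u \<in> borel_measurable lborel"
    unfolding u_def by measurable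
  have bound: "(\<integral>\<^sup>+x. ennreal ((u x - v k x)\<^sup>2) \<partial>lborel) \<le> ennreal (((1/4)^j)\<^sup>2)" if "k \<ge> j" for k j
  proof -
    have "(\<integral>\<^sup>+x. ennreal ((u x - v k x)\<^sup>2) \<partial>lborel)
            = (\<integral>\<^sup>+x. liminf (\<lambda>n. ennreal ((v n x - v k x)\<^sup>2)) \<partial>lborel)"
    proof (rule nn_integral_cong_AE, use conv in eventually_elim)
      case (elim x)
      then have "(\<lambda>n. v n x) \<longlonglongrightarrow> u x" by (simp add: u_def convergent_LIMSEQ_iff)
      then have "(\<lambda>n. ennreal ((v n x - v k x)\<^sup>2)) \<longlonglongrightarrow> ennreal ((u x - v k x)\<^sup>2)"
        by (intro tendsto_intros tendsto_ennrealI)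
      then show ?case by (intro lim_imp_Liminf[symmetric]) simp_all
    qed
    also have "\<dots> \<le> liminf (\<lambda>n. \<integral>\<^sup>+x. ennreal ((v n x - v k x)\<^sup>2) \<partial>lborel)"
      by (rule nn_integral_liminf) auto
    also have "\<dots> \<le> ennreal (((1/4)^j)\<^sup>2)"
    proof (rule Liminf_le)
      have "(\<integral>\<^sup>+x. ennreal ((v n x - v k x)\<^sup>2) \<partial>lborel) \<le> ennreal (((1/4)^j)\<^sup>2)" if "n \<ge> j" for n
      proof -
        have "N j \<le> r n" "N j \<le> r k"
          using rN[of j] \<open>j \<le> k\<close> \<open>j \<le> n\<close> strict_mono_less_eq[OF r] by (meson order_trans)+
        then have "norm (X (r n) - X (r k)) \<le> (1/4)^j" by (intro less_imp_le[OF N])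
        then show ?thesis
          by (simp add: nn_integral_norm_L2[OF square_integrable_diff[OF v v]]
              abs_v power_mono flip: diff_abs_L2[OF v v])
      qed
      then show "\<forall>\<^sub>F n in sequentially. (\<integral>\<^sup>+x. ennreal ((v n x - v k x)\<^sup>2) \<partial>lborel) \<le> ennreal (((1/4)^j)\<^sup>2)"
        by (auto simp: eventually_sequentially)
    qed simp
    finally show ?thesis .
  qed
  have diff: "square_integrable (\<lambda>x. u x - v k x)" for k
    unfolding square_integrable_def
    using bound[of 0 k] by (auto simp: integrable_iff_bounded intro: le_less_trans)
  then have u: "square_integrable u"
    using square_integrable_add[OF diff v, of 0 0] by simp
  have "norm (X (r k) - abs_L2 u) \<le> (1/4)^k" for k
  proof -
    have "ennreal ((norm (abs_L2 u - X (r k)))\<^sup>2) \<le> ennreal (((1/4)^k)\<^sup>2)"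
      using bound[of k k] by (simp add: nn_integral_norm_L2[OF diff] abs_v flip: diff_abs_L2[OF u v])
    then have "norm (abs_L2 u - X (r k)) \<le> (1/4)^k"
      by (simp add: power2_le_iff_abs_le)
    then show ?thesis by (simp add: norm_minus_commute)
  qed
  then have "(\<lambda>k. X (r k) - abs_L2 u) \<longlonglongrightarrow> 0"
    by (intro Lim_null_comparison[OF always_eventually LIMSEQ_realpow_zero]) auto
  then have "(X \<circ> r) \<longlonglongrightarrow> abs_L2 u"
    by (simp add: LIM_zero_iff comp_def)
  then show "convergent X"
    using Cauchy_converges_subseq[OF X r] by (auto simp: convergent_def)
qed

text \<open>
  $L^2(X)$ is identified, by extension by zero, with the closed subspace of those classes that
  vanish almost everywhere outside \<open>X\<close>.
\<close>

definition L2_on :: "real set \<Rightarrow> L2 set" where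
  "L2_on X = {u. AE x in lborel. x \<notin> X \<longrightarrow> rep_L2 u x = 0}"

text \<open>
  The multiplication operator by \<open>h\<close> on $L^2(X)$ with its maximal domain; only the values of \<open>h\<close>
  on \<open>X\<close> matter.  It is unbounded if \<open>h\<close> is.
\<close>

definition mult_dom :: "real set \<Rightarrow> (real \<Rightarrow> real) \<Rightarrow> L2 set" where
  "mult_dom X h = {u \<in> L2_on X. square_integrable (\<lambda>x. indicator X x * (h x * rep_L2 u x))}"

definition mult_op :: "real set \<Rightarrow> (real \<Rightarrow> real) \<Rightarrow> L2 \<Rightarrow> L2" where
  "mult_op X h u = abs_L2 (\<lambda>x. indicator X x * (h x * rep_L2 u x))"

section \<open>Strongly continuous semigroups on a subspace\<close>

definition C0_semigroup_on :: "'a::real_normed_vector set \<Rightarrow> (real \<Rightarrow> 'a \<Rightarrow> 'a) \<Rightarrow> bool" where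
  "C0_semigroup_on H S \<longleftrightarrow>
     (\<forall>t\<ge>0. (\<forall>u\<in>H. S t u \<in> H) \<and>
            (\<forall>u\<in>H. \<forall>v\<in>H. S t (u + v) = S t u + S t v) \<and>
            (\<forall>c. \<forall>u\<in>H. S t (c *\<^sub>R u) = c *\<^sub>R S t u) \<and>
            (\<exists>C. \<forall>u\<in>H. norm (S t u) \<le> C * norm u)) \<and>
     (\<forall>u\<in>H. S 0 u = u) \<and>
     (\<forall>s\<ge>0. \<forall>t\<ge>0. \<forall>u\<in>H. S (s + t) u = S s (S t u)) \<and>
     (\<forall>u\<in>H. continuous_on {0..} (\<lambda>t. S t u))"

text \<open>The (in general unbounded) operator \<open>A\<close> with domain \<open>D\<close> is the generator of \<open>S\<close>.\<close>

definition generates_on ::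
    "'a::real_normed_vector set \<Rightarrow> 'a set \<Rightarrow> ('a \<Rightarrow> 'a) \<Rightarrow> (real \<Rightarrow> 'a \<Rightarrow> 'a) \<Rightarrow> bool" where
  "generates_on H D A S \<longleftrightarrow>
     C0_semigroup_on H S \<and>
     (\<forall>u\<in>H. \<forall>w\<in>H. ((\<lambda>s. (S s u - u) /\<^sub>R s) \<longlongrightarrow> w) (at_right 0) \<longleftrightarrow> u \<in> D \<and> w = A u)"

text \<open>
  $e^{At}u$. A semigroup on a complete \<open>H\<close> is determined by its generator, so the choice only
  affects the irrelevant values for \<open>t < 0\<close> or \<open>u \<notin> H\<close>.
\<close>

definition exp_op :: "'a::real_normed_vector set \<Rightarrow> 'a set \<Rightarrow> ('a \<Rightarrow> 'a) \<Rightarrow> real \<Rightarrow> 'a \<Rightarrow> 'a" where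
  "exp_op H D A = (SOME S. generates_on H D A S)"

section \<open>Covariance operators\<close>

definition exp_mult :: "real set \<Rightarrow> (real \<Rightarrow> real) \<Rightarrow> real \<Rightarrow> L2 \<Rightarrow> L2" where
  "exp_mult X h = exp_op (L2_on X) (mult_dom X h) (mult_op X h)"

text \<open>
  The operator-valued integral and the limit $t\to\infty$ are taken in the strong sense, that is,
  in $L^2(X)$ after application to a vector \<open>u\<close>.
\<close>

definition cov_op ::
    "real set \<Rightarrow> (real \<Rightarrow> real) \<Rightarrow> real \<Rightarrow> (L2 \<Rightarrow> L2) \<Rightarrow> real \<Rightarrow> L2 \<Rightarrow> L2" where
  "cov_op X h \<sigma> Q t u =
     \<sigma>\<^sup>2 *\<^sub>R integral {0..t} (\<lambda>s. exp_mult X h s (Q (exp_mult X h s u)))"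

definition cov_inf ::
    "real set \<Rightarrow> (real \<Rightarrow> real) \<Rightarrow> real \<Rightarrow> (L2 \<Rightarrow> L2) \<Rightarrow> L2 \<Rightarrow> L2" where
  "cov_inf X h \<sigma> Q u = Lim at_top (\<lambda>t. cov_op X h \<sigma> Q t u)"

section \<open>Sharp order as $p \to 0^-$\<close>

text \<open>
  Stronger than the usual \<open>bigtheta\<close>: the quotients have to converge.  The limits are finite,
  which is automatic, since each is the reciprocal of the other.
\<close>

definition Theta_left0 :: "(real \<Rightarrow> real) \<Rightarrow> (real \<Rightarrow> real) \<Rightarrow> bool" where
  "Theta_left0 b1 b2 \<longleftrightarrow>
     (\<forall>\<^sub>F p in at_left 0. b1 p > 0) \<and> (\<forall>\<^sub>F p in at_left 0. b2 p > 0) \<and>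
     (\<exists>L>0. ((\<lambda>p. b1 p / b2 p) \<longlongrightarrow> L) (at_left 0)) \<and>
     (\<exists>L>0. ((\<lambda>p. b2 p / b1 p) \<longlongrightarrow> L) (at_left 0))"

end

theory Submission
  imports Defs "HOL-Real_Asymp.Real_Asymp"
begin

text \<open>
  The semigroup generated by multiplication with \<open>h = f + p\<close> is multiplication by \<open>exp (t * h)\<close>.
  With \<open>Q = I\<close> the covariance at time \<open>t\<close> is therefore multiplication by
  \<open>\<sigma>\<^sup>2 * (exp (2 * t * h) - 1) / (2 * h)\<close>, and since \<open>h \<le> p < 0\<close> it converges to multiplication
  by \<open>\<sigma>\<^sup>2 / (2 * \<bar>h\<bar>)\<close>. With \<open>q = - p\<close>, everything comes down to the scalar integral of
  \<open>1 / (q - f x)\<close> over \<open>[0, \<epsilon>]\<close> as \<open>q\<close> tends to \<open>0\<close> from the right.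

  The exponential of an unbounded operator is only characterised as some semigroup with the given
  generator, so its identification with multiplication by \<open>exp (t * h)\<close> needs two facts: that the
  multiplication semigroup has precisely the maximal multiplication operator as generator
  (\<open>mult_semigroup_generates\<close>), and that this generator determines the semigroup
  (\<open>generates_on_dissipative_unique\<close>). Because \<open>h \<le> 0\<close>, the generator is dissipative, and the
  uniqueness follows from an energy estimate: the squared distance of two orbits has nonpositive
  right derivative.
  The formula for the limit covariance (\<open>cov_inf_eq\<close>) is then the fundamental theorem of calculus,
  with the primitive \<open>exp (2 * t * h) * u / (2 * h)\<close>.

  For the scalar integral write \<open>- f x = x ^ m * G x\<close> with \<open>G\<close> continuous and positive on
  \<open>[0, \<epsilon>]\<close>. The point \<open>\<epsilon>\<close> may lie on the boundary of the interval of convergence, so the continuity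
  of \<open>G\<close> there is Abel's limit theorem. For \<open>m \<ge> 2\<close> the substitution \<open>x = q powr (1 / m) * y\<close> turns the
  integral into \<open>q powr (-1 + 1 / m)\<close> times an integral that converges, by dominated convergence, to
  the integral of \<open>1 / (G 0 * y ^ m + 1)\<close> over the half-line (\<open>integral_asymptotics_power\<close>). For
  \<open>m = 1\<close> that limit integral diverges; instead, replacing \<open>G\<close> by the constant \<open>G 0\<close>
  changes the integral by a bounded amount only, and the simplified integral is an explicit
  logarithm (\<open>integral_asymptotics_log\<close>).
\<close>

section \<open>Convergence in the space of square-integrable functions\<close>

lemma square_integrable_measurable: "square_integrable u \<Longrightarrow> u \<in> borel_measurable borel"
  by (simp add: square_integrable_def)

lemma square_integrable_bound:
  assumes "square_integrable w" "v \<in> borel_measurable borel" "\<And>x. \<bar>v x\<bar> \<le> \<bar>w x\<bar>"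
  shows "square_integrable v"
  unfolding square_integrable_def
proof
  show "integrable lborel (\<lambda>x. (v x)\<^sup>2)"
  proof (rule Bochner_Integration.integrable_bound)
    show "integrable lborel (\<lambda>x. (w x)\<^sup>2)"
      using assms(1) by (simp add: square_integrable_def)
    show "AE x in lborel. norm ((v x)\<^sup>2) \<le> norm ((w x)\<^sup>2)"
      using assms(3) by (simp add: abs_le_square_iff)
  qed (use assms(2) in measurable)
qed (use assms(2) in simp)

lemma add_abs_L2:
  assumes "square_integrable u" "square_integrable v"
  shows "abs_L2 u + abs_L2 v = abs_L2 (\<lambda>x. u x + v x)"
  using assms by (intro plus_L2.abs_eq) (auto simp: L2_rel_def)

lemma scaleR_abs_L2:
  assumes "square_integrable u"
  shows "c *\<^sub>R abs_L2 u = abs_L2 (\<lambda>x. c * u x)"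
  using assms by (intro scaleR_L2.abs_eq) (auto simp: L2_rel_def)

lemma inner_abs_L2:
  assumes "square_integrable u" "square_integrable v"
  shows "inner (abs_L2 u) (abs_L2 v) = (LINT x|lborel. u x * v x)"
  using assms by (subst inner_L2.abs_eq) (auto simp: L2_rel_def)

lemma abs_L2_in_L2_on:
  assumes "square_integrable u"
  shows "abs_L2 u \<in> L2_on X \<longleftrightarrow> (AE x in lborel. x \<notin> X \<longrightarrow> u x = 0)"
  unfolding L2_on_def mem_Collect_eq
proof
  assume "AE x in lborel. x \<notin> X \<longrightarrow> rep_L2 (abs_L2 u) x = 0"
  with rep_abs_L2[OF assms] show "AE x in lborel. x \<notin> X \<longrightarrow> u x = 0"
    by eventually_elim auto
next
  assume "AE x in lborel. x \<notin> X \<longrightarrow> u x = 0"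
  with rep_abs_L2[OF assms] show "AE x in lborel. x \<notin> X \<longrightarrow> rep_L2 (abs_L2 u) x = 0"
    by eventually_elim auto
qed

lemma tendsto_abs_L2_iff:
  assumes "\<And>n. square_integrable (v n)" "square_integrable v0"
  shows "((\<lambda>n. abs_L2 (v n)) \<longlongrightarrow> abs_L2 v0) F \<longleftrightarrow>
         ((\<lambda>n. LINT x|lborel. (v n x - v0 x)\<^sup>2) \<longlongrightarrow> 0) F"
proof -
  have "((\<lambda>n. abs_L2 (v n)) \<longlongrightarrow> abs_L2 v0) F \<longleftrightarrow>
        ((\<lambda>n. (norm (abs_L2 (v n) - abs_L2 v0))\<^sup>2) \<longlongrightarrow> 0) F"
    by (subst Lim_null) (simp add: tendsto_norm_zero_iff)
  then show ?thesis
    using assms by (simp add: diff_abs_L2 norm_abs_L2 square_integrable_diff)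
qed

lemma L2_dominated_convergence_sequentially:
  assumes w: "square_integrable w"
    and v: "\<And>n. v n \<in> borel_measurable borel" "\<And>n x. \<bar>v n x\<bar> \<le> \<bar>w x\<bar>"
    and lim: "\<And>x. (\<lambda>n. v n x) \<longlonglongrightarrow> v0 x"
  shows "(\<lambda>n. abs_L2 (v n)) \<longlonglongrightarrow> abs_L2 v0"
proof -
  have v0: "v0 \<in> borel_measurable borel"
    by (rule borel_measurable_LIMSEQ_real[OF lim v(1)])
  have v0_bound: "\<bar>v0 x\<bar> \<le> \<bar>w x\<bar>" for x
    by (rule LIMSEQ_le_const2[OF tendsto_rabs[OF lim]]) (use v(2) in auto)
  have sq: "square_integrable (v n)" "square_integrable v0" for n
    using square_integrable_bound[OF w] v v0 v0_bound by auto
  have "(\<lambda>n. LINT x|lborel. (v n x - v0 x)\<^sup>2) \<longlonglongrightarrow> (LINT (x::real)|lborel. 0)"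
  proof (rule integral_dominated_convergence)
    show "integrable lborel (\<lambda>x. (2 * w x)\<^sup>2)"
      using square_integrable_scale[OF w, of 2] by (simp add: square_integrable_def)
    show "AE x in lborel. (\<lambda>n. (v n x - v0 x)\<^sup>2) \<longlonglongrightarrow> 0"
      using lim by (auto intro!: always_eventually tendsto_eq_intros)
    show "AE x in lborel. norm ((v n x - v0 x)\<^sup>2) \<le> (2 * w x)\<^sup>2" for n
    proof (rule AE_I2)
      fix x
      have "\<bar>v n x - v0 x\<bar> \<le> \<bar>2 * w x\<bar>"
        using v(2)[of n x] v0_bound[of x] by linarith
      then show "norm ((v n x - v0 x)\<^sup>2) \<le> (2 * w x)\<^sup>2"
        by (simp add: abs_le_square_iff)
    qed
  qed (use v v0 in measurable)
  then show ?thesis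
    using sq by (simp add: tendsto_abs_L2_iff)
qed

text \<open>
  A limit at a point of the line is a statement about sequences, so dominated convergence extends
  from sequences to a real parameter.
\<close>

lemma L2_dominated_convergence:
  fixes a :: real
  assumes w: "square_integrable w"
    and v: "\<And>s. s \<in> A - {a} \<Longrightarrow> v s \<in> borel_measurable borel"
      "\<And>s x. s \<in> A - {a} \<Longrightarrow> \<bar>v s x\<bar> \<le> \<bar>w x\<bar>"
    and lim: "\<And>x. ((\<lambda>s. v s x) \<longlongrightarrow> v0 x) (at a within A)"
  shows "((\<lambda>s. abs_L2 (v s)) \<longlongrightarrow> abs_L2 v0) (at a within A)"
  unfolding tendsto_at_iff_sequentially comp_def
proof (intro allI impI)
  fix r assume r: "\<forall>i. r i \<in> A - {a}" "r \<longlonglongrightarrow> a"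
  show "(\<lambda>i. abs_L2 (v (r i))) \<longlonglongrightarrow> abs_L2 v0"
  proof (rule L2_dominated_convergence_sequentially[OF w])
    show "(\<lambda>i. v (r i) x) \<longlonglongrightarrow> v0 x" for x
      using lim[of x] r unfolding tendsto_at_iff_sequentially comp_def by blast
  qed (use v r in auto)
qed

text \<open>
  Convergence in mean square yields almost everywhere convergence of a subsequence, so it cannot
  disagree with a pointwise limit. This is what confines the domain of the generator to the functions
  whose product with the multiplier is again square-integrable.
\<close>

lemma abs_L2_limit_unique_pointwise:
  assumes sq: "\<And>n. square_integrable (v n)" "square_integrable w"
    and L2: "(\<lambda>n. abs_L2 (v n)) \<longlonglongrightarrow> abs_L2 w"
    and lim: "\<And>x. (\<lambda>n. v n x) \<longlonglongrightarrow> v0 x"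
  shows "AE x in lborel. v0 x = w x"
proof -
  have "(\<lambda>n. LINT x|lborel. norm ((v n x - w x)\<^sup>2)) \<longlonglongrightarrow> 0"
    using L2 sq by (simp add: tendsto_abs_L2_iff)
  moreover have "integrable lborel (\<lambda>x. (v n x - w x)\<^sup>2)" for n
    using square_integrable_diff[OF sq] by (simp add: square_integrable_def)
  ultimately obtain r where r: "strict_mono r"
      and ae: "AE x in lborel. (\<lambda>n. (v (r n) x - w x)\<^sup>2) \<longlonglongrightarrow> 0"
    using tendsto_L1_AE_subseq[of lborel "\<lambda>n x. (v n x - w x)\<^sup>2"] by blast
  from ae show ?thesis
  proof eventually_elim
    case (elim x)
    have "(\<lambda>n. (v (r n) x - w x)\<^sup>2) \<longlonglongrightarrow> (v0 x - w x)\<^sup>2"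
      using LIMSEQ_subseq_LIMSEQ[OF lim[of x] r] by (auto intro!: tendsto_intros simp: comp_def)
    from LIMSEQ_unique[OF this elim] show "v0 x = w x"
      by simp
  qed
qed

section \<open>Orbits under multiplication by exponentials\<close>

lemma has_vector_derivative_iff_quotient:
  "(f has_vector_derivative D) (at x within S) \<longleftrightarrow>
   ((\<lambda>y. (f y - f x) /\<^sub>R (y - x)) \<longlongrightarrow> D) (at x within S)"
proof -
  have "(f has_vector_derivative D) (at x within S) \<longleftrightarrow>
        ((\<lambda>y. norm ((f y - f x) - (y - x) *\<^sub>R D) / norm (y - x)) \<longlongrightarrow> 0) (at x within S)"
    unfolding has_vector_derivative_def has_derivative_iff_norm
    by (simp add: bounded_linear_scaleR_left)
  also have "\<dots> \<longleftrightarrow> ((\<lambda>y. norm ((f y - f x) /\<^sub>R (y - x) - D)) \<longlongrightarrow> 0) (at x within S)"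
  proof (rule tendsto_cong)
    have "norm ((f y - f x) - (y - x) *\<^sub>R D) / norm (y - x) = norm ((f y - f x) /\<^sub>R (y - x) - D)"
      if "y \<noteq> x" for y
    proof -
      have "(f y - f x) /\<^sub>R (y - x) - D = ((f y - f x) - (y - x) *\<^sub>R D) /\<^sub>R (y - x)"
        using that by (simp add: scaleR_diff_right)
      then show ?thesis
        by (simp add: divide_inverse mult.commute)
    qed
    then show "\<forall>\<^sub>F y in at x within S. norm ((f y - f x) - (y - x) *\<^sub>R D) / norm (y - x) =
        norm ((f y - f x) /\<^sub>R (y - x) - D)"
      by (simp add: eventually_at_filter)
  qed
  also have "\<dots> \<longleftrightarrow> ((\<lambda>y. (f y - f x) /\<^sub>R (y - x)) \<longlongrightarrow> D) (at x within S)"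
    unfolding tendsto_norm_zero_iff by (simp add: Lim_null[of _ D])
  finally show ?thesis .
qed

text \<open>
  The exponent \<open>k\<close> lives on the whole line. For an equation on \<open>X\<close> it is the extension by zero of the
  multiplier, so that the factor is \<open>1\<close> outside \<open>X\<close>, where all functions in question vanish.
\<close>

definition mult_semigroup :: "(real \<Rightarrow> real) \<Rightarrow> real \<Rightarrow> L2 \<Rightarrow> L2" where
  "mult_semigroup k t u = abs_L2 (\<lambda>x. exp (t * k x) * rep_L2 u x)"

lemma exp_nonpos_Lipschitz:
  fixes s t k :: real
  assumes "s \<ge> 0" "t \<ge> 0" "k \<le> 0"
  shows "\<bar>exp (s * k) - exp (t * k)\<bar> \<le> \<bar>s - t\<bar> * \<bar>k\<bar>"
proof -
  have *: "\<bar>exp (s * k) - exp (t * k)\<bar> \<le> \<bar>s - t\<bar> * \<bar>k\<bar>" if "0 \<le> s" "s \<le> t" for s t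
  proof -
    have "1 + (t - s) * k \<le> exp ((t - s) * k)" by (rule exp_ge_add_one_self)
    then have "1 - exp ((t - s) * k) \<le> (t - s) * \<bar>k\<bar>" using assms(3) by (simp add: algebra_simps)
    moreover have "exp ((t - s) * k) \<le> 1" "exp (s * k) \<le> 1"
      using assms(3) that by (simp_all add: mult_nonneg_nonpos)
    moreover have "exp (s * k) - exp (t * k) = exp (s * k) * (1 - exp ((t - s) * k))"
      by (simp add: algebra_simps flip: exp_add)
    ultimately have "0 \<le> exp (s * k) - exp (t * k)" "exp (s * k) - exp (t * k) \<le> 1 * ((t - s) * \<bar>k\<bar>)"
      by (simp, metis mult_mono exp_ge_zero diff_ge_0_iff_ge zero_le_one)
    then show ?thesis using that by simp
  qed
  show ?thesis
    using *[of s t] *[of t s] assms by (cases "s \<le> t") (auto simp: abs_minus_commute)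
qed

context
  fixes k :: "real \<Rightarrow> real"
  assumes k_measurable [measurable]: "k \<in> borel_measurable borel"
    and k_nonpos: "\<And>x. k x \<le> 0"
begin

lemma exp_k_le_1: "t \<ge> 0 \<Longrightarrow> exp (t * k x) \<le> 1"
  using k_nonpos[of x] by (simp add: mult_nonneg_nonpos)

lemma square_integrable_exp_mult:
  assumes "square_integrable u" "t \<ge> 0"
  shows "square_integrable (\<lambda>x. exp (t * k x) * u x)"
  using square_integrable_measurable[OF assms(1)] exp_k_le_1[OF assms(2)]
  by (intro square_integrable_bound[OF assms(1)]) (auto simp: abs_mult mult_left_le_one_le)

lemma mult_semigroup_abs:
  assumes "square_integrable u" "t \<ge> 0"
  shows "mult_semigroup k t (abs_L2 u) = abs_L2 (\<lambda>x. exp (t * k x) * u x)"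
  unfolding mult_semigroup_def
  using rep_abs_L2[OF assms(1)]
  by (subst abs_L2_eq_iff) (auto intro!: square_integrable_exp_mult assms square_integrable_rep_L2)

lemma norm_mult_semigroup_le:
  assumes "t \<ge> 0" "p \<le> 0" "AE x in lborel. k x \<le> p \<or> rep_L2 u x = 0"
  shows "norm (mult_semigroup k t u) \<le> exp (t * p) * norm u"
proof -
  let ?r = "rep_L2 u"
  have r: "square_integrable ?r" by (rule square_integrable_rep_L2)
  have "(norm (mult_semigroup k t u))\<^sup>2 = (LINT x|lborel. (exp (t * k x) * ?r x)\<^sup>2)"
    using r assms unfolding mult_semigroup_def by (intro norm_abs_L2 square_integrable_exp_mult)
  also have "\<dots> \<le> (LINT x|lborel. (exp (t * p))\<^sup>2 * (?r x)\<^sup>2)"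
  proof (rule integral_mono_AE)
    show "integrable lborel (\<lambda>x. (exp (t * k x) * ?r x)\<^sup>2)" 
      using square_integrable_exp_mult[OF r assms(1)] by (simp add: square_integrable_def)
    show "integrable lborel (\<lambda>x. (exp (t * p))\<^sup>2 * (?r x)\<^sup>2)"
      using r by (simp add: square_integrable_def)
    show "AE x in lborel. (exp (t * k x) * ?r x)\<^sup>2 \<le> (exp (t * p))\<^sup>2 * (?r x)\<^sup>2"
      using assms(3)
    proof eventually_elim
      case (elim x)
      then show ?case
        using assms(1) by (cases "rep_L2 u x = 0")
          (auto simp: power_mult_distrib intro!: mult_right_mono power_mono mult_left_mono)
    qed
  qed
  also have "\<dots> = (exp (t * p) * norm u)\<^sup>2"
    using norm_abs_L2[OF r] by (simp add: abs_rep_L2 power_mult_distrib)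
  finally show ?thesis
    by (rule power2_le_imp_le) simp
qed


text \<open>
  The difference quotients converge pointwise, and by the Lipschitz bound on the exponential they are
  dominated by \<open>\<bar>k * u\<bar>\<close>, which is square-integrable by assumption.
\<close>

lemma has_vector_derivative_mult_semigroup:
  assumes u: "square_integrable u" "square_integrable (\<lambda>x. k x * u x)" and t: "t \<ge> 0"
  shows "((\<lambda>s. mult_semigroup k s (abs_L2 u)) has_vector_derivative
          mult_semigroup k t (abs_L2 (\<lambda>x. k x * u x))) (at t within {0..})"
proof -
  have um: "u \<in> borel_measurable borel" using u(1) by (rule square_integrable_measurable)
  let ?q = "\<lambda>s x. (exp (s * k x) - exp (t * k x)) / (s - t) * u x"
  have "((\<lambda>s. abs_L2 (?q s)) \<longlongrightarrow> abs_L2 (\<lambda>x. exp (t * k x) * (k x * u x))) (at t within {0..})"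
  proof (rule L2_dominated_convergence[OF u(2)])
    fix s assume s: "s \<in> {0..} - {t}"
    show "?q s \<in> borel_measurable borel" using um by measurable
    show "\<bar>?q s x\<bar> \<le> \<bar>k x * u x\<bar>" for x
    proof -
      have "\<bar>(exp (s * k x) - exp (t * k x)) / (s - t)\<bar> \<le> \<bar>k x\<bar>"
        using exp_nonpos_Lipschitz[of s t "k x"] s t k_nonpos by (simp add: field_simps)
      then show ?thesis
        unfolding abs_mult by (rule mult_right_mono) simp
    qed
  next
    fix x
    have "((\<lambda>s. exp (s * k x)) has_field_derivative exp (t * k x) * k x) (at t within {0..})"
      by (auto intro!: derivative_eq_intros)
    then have "((\<lambda>s. (exp (s * k x) - exp (t * k x)) / (s - t)) \<longlongrightarrow> exp (t * k x) * k x) (at t within {0..})"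
      by (simp add: has_field_derivative_iff)
    from tendsto_mult_right[OF this, of "u x"]
    show "((\<lambda>s. ?q s x) \<longlongrightarrow> exp (t * k x) * (k x * u x)) (at t within {0..})"
      by (simp add: mult.assoc)
  qed
  moreover have "\<forall>\<^sub>F s in at t within {0..}. abs_L2 (?q s) =
      (mult_semigroup k s (abs_L2 u) - mult_semigroup k t (abs_L2 u)) /\<^sub>R (s - t)"
    unfolding eventually_at_filter
  proof (intro always_eventually allI impI)
    fix s assume "s \<noteq> t" "s \<in> {0..}"
    then have "(mult_semigroup k s (abs_L2 u) - mult_semigroup k t (abs_L2 u)) /\<^sub>R (s - t) =
        abs_L2 (\<lambda>x. inverse (s - t) * (exp (s * k x) * u x - exp (t * k x) * u x))"
      using u t by (simp add: mult_semigroup_abs diff_abs_L2 scaleR_abs_L2 square_integrable_exp_mult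
          square_integrable_diff)
    also have "\<dots> = abs_L2 (?q s)"
      by (rule arg_cong[of _ _ abs_L2]) (simp add: fun_eq_iff divide_inverse algebra_simps)
    finally show "abs_L2 (?q s) =
        (mult_semigroup k s (abs_L2 u) - mult_semigroup k t (abs_L2 u)) /\<^sub>R (s - t)" ..
  qed
  ultimately show ?thesis
    using u t unfolding has_vector_derivative_iff_quotient
    by (simp add: mult_semigroup_abs tendsto_cong)
qed

end

section \<open>Uniqueness of the semigroup with a dissipative generator\<close>

text \<open>
  A one-sided derivative suffices for monotonicity. After subtracting a small linear function the
  right derivative is strictly negative, so the function drops below zero immediately after the
  last time at which it is nonpositive; this is a contradiction unless that time is the end point.
\<close>

lemma right_derivative_nonpos_imp_le:
  fixes \<phi> :: "real \<Rightarrow> real"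
  assumes cont: "continuous_on {0..} \<phi>"
    and der: "\<And>t. t \<ge> 0 \<Longrightarrow> \<exists>D\<le>0. ((\<lambda>s. (\<phi> (t + s) - \<phi> t) / s) \<longlongrightarrow> D) (at_right 0)"
    and t: "t \<ge> 0"
  shows "\<phi> t \<le> \<phi> 0"
proof (rule field_le_epsilon)
  fix d :: real assume "d > 0"
  \<comment> \<open>The denominator only has to be positive and at least \<open>t\<close>.\<close>
  define e where "e = d / (t + 1)"
  have e: "e > 0" "e * t \<le> d" using \<open>d > 0\<close> t by (auto simp: e_def field_simps)
  define \<psi> where "\<psi> s = \<phi> s - \<phi> 0 - e * s" for s
  have "\<psi> t \<le> 0"
  proof (rule ccontr)
    assume pos: "\<not> \<psi> t \<le> 0"
    define Z where "Z = {s \<in> {0..t}. \<psi> s \<le> 0}"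
    have "continuous_on {0..t} \<psi>"
      unfolding \<psi>_def by (intro continuous_intros continuous_on_subset[OF cont]) auto
    then have "closed Z"
      unfolding Z_def by (intro continuous_on_closed_Collect_le) (auto intro: continuous_intros)
    then have "compact Z"
      unfolding compact_eq_bounded_closed
      by (auto intro: bounded_subset[OF bounded_closed_interval] simp: Z_def)
    moreover have "0 \<in> Z" using t by (simp add: Z_def \<psi>_def)
    ultimately obtain c where c: "c \<in> Z" and c_max: "\<And>s. s \<in> Z \<Longrightarrow> s \<le> c"
      using compact_attains_sup[of Z] by blast
    have c0: "0 \<le> c" "c < t" "\<psi> c \<le> 0"
      using c pos by (auto simp: Z_def less_le)
    obtain D where D: "D \<le> 0" "((\<lambda>s. (\<phi> (c + s) - \<phi> c) / s) \<longlongrightarrow> D) (at_right 0)"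
      using der[OF c0(1)] by blast
    have "\<forall>\<^sub>F s in at_right 0. (\<phi> (c + s) - \<phi> c) / s < e"
      using D e by (intro order_tendstoD(2)[OF D(2)]) simp
    moreover have "\<forall>\<^sub>F s in at_right 0. s \<in> {0<..<t - c}"
      using c0 by (intro eventually_at_right_real) simp
    ultimately have "\<forall>\<^sub>F s in at_right 0. (\<phi> (c + s) - \<phi> c) / s < e \<and> s \<in> {0<..<t - c}"
      by eventually_elim simp
    then obtain s where s: "(\<phi> (c + s) - \<phi> c) / s < e" "s \<in> {0<..<t - c}"
      using eventually_happens'[OF trivial_limit_at_right_real] by blast
    then have "\<psi> (c + s) \<le> \<psi> c"
      by (simp add: \<psi>_def field_simps)
    then have "c + s \<in> Z" using s c0 by (simp add: Z_def)
    then show False using c_max s by fastforce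
  qed
  then show "\<phi> t \<le> \<phi> 0 + d" using e by (simp add: \<psi>_def)
qed

lemma generates_onD:
  assumes "generates_on H D A S"
  shows "C0_semigroup_on H S"
    and "u \<in> H \<Longrightarrow> w \<in> H \<Longrightarrow>
      ((\<lambda>s. (S s u - u) /\<^sub>R s) \<longlongrightarrow> w) (at_right 0) \<longleftrightarrow> u \<in> D \<and> w = A u"
proof -
  show "C0_semigroup_on H S"
    using assms unfolding generates_on_def by (rule conjunct1)
  show "((\<lambda>s. (S s u - u) /\<^sub>R s) \<longlongrightarrow> w) (at_right 0) \<longleftrightarrow> u \<in> D \<and> w = A u" if "u \<in> H" "w \<in> H"
    by (rule assms[unfolded generates_on_def, THEN conjunct2, THEN bspec, THEN bspec, OF that])
qed

lemma C0_semigroup_onD: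
  assumes "C0_semigroup_on H S" "t \<ge> 0" "u \<in> H"
  shows "S t u \<in> H" "S t (c *\<^sub>R u) = c *\<^sub>R S t u"
    and "v \<in> H \<Longrightarrow> S t (u + v) = S t u + S t v"
    and "s \<ge> 0 \<Longrightarrow> S (s + t) u = S s (S t u)"
    and "S 0 u = u" and "continuous_on {0..} (\<lambda>t. S t u)"
proof -
  note C0 = assms(1)[unfolded C0_semigroup_on_def]
  note S_t = C0[THEN conjunct1, THEN spec, THEN mp, OF assms(2)]
  show "S t u \<in> H"
    by (rule S_t[THEN conjunct1, THEN bspec, OF assms(3)])
  show "S t (c *\<^sub>R u) = c *\<^sub>R S t u"
    by (rule S_t[THEN conjunct2, THEN conjunct2, THEN conjunct1, THEN spec, THEN bspec, OF assms(3)])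
  show "S t (u + v) = S t u + S t v" if "v \<in> H"
    by (rule S_t[THEN conjunct2, THEN conjunct1, THEN bspec, THEN bspec, OF assms(3) that])
  show "S 0 u = u"
    by (rule C0[THEN conjunct2, THEN conjunct1, THEN bspec, OF assms(3)])
  show "S (s + t) u = S s (S t u)" if "s \<ge> 0"
    by (rule C0[THEN conjunct2, THEN conjunct2, THEN conjunct1, THEN spec, THEN mp, OF that,
          THEN spec, THEN mp, OF assms(2), THEN bspec, OF assms(3)])
  show "continuous_on {0..} (\<lambda>t. S t u)"
    by (rule C0[THEN conjunct2, THEN conjunct2, THEN conjunct2, THEN bspec, OF assms(3)])
qed

lemma C0_semigroup_on_bounded:
  assumes "C0_semigroup_on H S" "t \<ge> 0"
  obtains C where "\<And>u. u \<in> H \<Longrightarrow> norm (S t u) \<le> C * norm u"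
proof -
  have "\<exists>C. \<forall>u\<in>H. norm (S t u) \<le> C * norm u"
    using assms(1)[unfolded C0_semigroup_on_def, THEN conjunct1, THEN spec, THEN mp, OF assms(2)]
    by (elim conjE)
  then show ?thesis using that by blast
qed

lemma C0_semigroup_on_diff:
  assumes "subspace H" "C0_semigroup_on H S" "t \<ge> 0" "u \<in> H" "v \<in> H"
  shows "S t (u - v) = S t u - S t v"
proof -
  have "S t (u + (-1) *\<^sub>R v) = S t u + S t ((-1) *\<^sub>R v)"
    by (rule C0_semigroup_onD(3)[OF assms(2-4)]) (rule subspace_scale[OF assms(1,5)])
  also have "S t ((-1) *\<^sub>R v) = (-1) *\<^sub>R S t v"
    by (rule C0_semigroup_onD(2)[OF assms(2,3,5)])
  finally show ?thesis by simp
qed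

lemma C0_semigroup_on_tendsto:
  assumes H: "subspace H" "C0_semigroup_on H S" "t \<ge> 0"
    and x: "\<forall>\<^sub>F s in F. x s \<in> H" "y \<in> H" "(x \<longlongrightarrow> y) F"
  shows "((\<lambda>s. S t (x s)) \<longlongrightarrow> S t y) F"
proof -
  obtain C where C: "\<And>u. u \<in> H \<Longrightarrow> norm (S t u) \<le> C * norm u"
    using C0_semigroup_on_bounded[OF H(2,3)] by blast
  have "((\<lambda>s. S t (x s) - S t y) \<longlongrightarrow> 0) F"
  proof (rule Lim_null_comparison)
    show "\<forall>\<^sub>F s in F. norm (S t (x s) - S t y) \<le> C * norm (x s - y)"
      using x(1)
    proof eventually_elim
      case (elim s)
      show ?case
        using C[OF subspace_diff[OF H(1) elim x(2)]] C0_semigroup_on_diff[OF H elim x(2)] by simp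
    qed
    show "((\<lambda>s. C * norm (x s - y)) \<longlongrightarrow> 0) F"
      using x(3) by (intro tendsto_mult_right_zero) (simp add: tendsto_norm_zero_iff LIM_zero_iff)
  qed
  then show ?thesis by (simp add: LIM_zero_iff)
qed

text \<open>
  An orbit that starts in the domain stays there and solves the abstract Cauchy problem. The difference
  quotient of the orbit at time \<open>t\<close> has two readings: as \<open>S t\<close> applied to the difference quotient at
  time \<open>0\<close>, which converges because \<open>S t\<close> is bounded, and as the difference quotient at \<open>0\<close> of the
  orbit of \<open>S t u\<close>, whose convergence is membership in the domain. Only right derivatives arise in
  this way; left ones would require a bound on \<open>S\<close> that is locally uniform in time.
\<close>

lemma generates_on_orbit:
  assumes H: "subspace H" "D \<subseteq> H" "A ` D \<subseteq> H"
    and S: "generates_on H D A S"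
    and u: "u \<in> D" and t: "t \<ge> 0"
  shows "S t u \<in> D"
    and "((\<lambda>s. (S (t + s) u - S t u) /\<^sub>R s) \<longlongrightarrow> A (S t u)) (at_right 0)"
proof -
  note C0 = generates_onD(1)[OF S]
  have uH: "u \<in> H" "A u \<in> H" using H u by auto
  note StH = C0_semigroup_onD(1)[OF C0]
  let ?x = "\<lambda>s. (S s u - u) /\<^sub>R s"
  have x: "(?x \<longlongrightarrow> A u) (at_right 0)"
    using generates_onD(2)[OF S uH] u by blast
  have pos: "\<forall>\<^sub>F s :: real in at_right 0. s > 0"
    by (simp add: eventually_at_filter)
  have xH: "?x s \<in> H" if "s > 0" for s
    using that StH[of s u] uH by (intro subspace_scale subspace_diff H) auto
  have "((\<lambda>s. S t (?x s)) \<longlongrightarrow> S t (A u)) (at_right 0)"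
    by (rule C0_semigroup_on_tendsto[OF H(1) C0 t _ uH(2) x]) (use pos in eventually_elim, rule xH)
  moreover have "\<forall>\<^sub>F s in at_right 0. S t (?x s) = (S (t + s) u - S t u) /\<^sub>R s"
    using pos
  proof eventually_elim
    case (elim s)
    then have su: "S s u \<in> H" using StH[of s u] uH by simp
    show ?case
      using elim C0_semigroup_onD(2)[OF C0 t subspace_diff[OF H(1) su uH(1)]]
        C0_semigroup_on_diff[OF H(1) C0 t su uH(1)] C0_semigroup_onD(4)[OF C0 _ uH(1) t, of s]
      by simp
  qed
  ultimately have lim: "((\<lambda>s. (S (t + s) u - S t u) /\<^sub>R s) \<longlongrightarrow> S t (A u)) (at_right 0)"
    by (simp add: tendsto_cong)
  moreover have "\<forall>\<^sub>F s in at_right 0. (S (t + s) u - S t u) /\<^sub>R s = (S s (S t u) - S t u) /\<^sub>R s"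
    using pos
  proof eventually_elim
    case (elim s)
    then show ?case
      using C0_semigroup_onD(4)[OF C0 t uH(1), of s] by (simp add: add.commute[of t s])
  qed
  ultimately have "((\<lambda>s. (S s (S t u) - S t u) /\<^sub>R s) \<longlongrightarrow> S t (A u)) (at_right 0)"
    by (simp add: tendsto_cong)
  then have *: "S t u \<in> D \<and> S t (A u) = A (S t u)"
    using generates_onD(2)[OF S StH[OF t uH(1)] StH[OF t uH(2)]] by blast
  show "S t u \<in> D" using * by simp
  show "((\<lambda>s. (S (t + s) u - S t u) /\<^sub>R s) \<longlongrightarrow> A (S t u)) (at_right 0)"
    using lim * by simp
qed

text \<open>
  For \<open>u\<close> in the domain, the squared norm of \<open>S t u - T t u\<close> has right derivative
  \<open>2 * inner (A (S t u) - A (T t u)) (S t u - T t u) \<le> 0\<close> and vanishes at time \<open>0\<close>, hence always.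
  Density of the domain and boundedness of \<open>S t\<close> and \<open>T t\<close> give the other vectors.
\<close>

lemma generates_on_dissipative_unique:
  fixes A :: "'a::real_inner \<Rightarrow> 'a"
  assumes H: "subspace H" "D \<subseteq> H" "A ` D \<subseteq> H" and dense: "H \<subseteq> closure D"
    and dissipative: "\<And>v w. v \<in> D \<Longrightarrow> w \<in> D \<Longrightarrow> inner (A v - A w) (v - w) \<le> 0"
    and S: "generates_on H D A S" and T: "generates_on H D A T"
    and u: "u \<in> H" and t: "t \<ge> 0"
  shows "S t u = T t u"
proof -
  note C0 = generates_onD(1)[OF S] generates_onD(1)[OF T]
  have on_D: "S t v = T t v" if v: "v \<in> D" for v
  proof -
    have vH: "v \<in> H" using v H by auto
    define y where "y r = S r v - T r v" for r
    have y_cont: "continuous_on {0..} y"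
      unfolding y_def using C0 vH by (intro continuous_on_diff C0_semigroup_onD(6)[OF _ t])
    have "(norm (y t))\<^sup>2 \<le> (norm (y 0))\<^sup>2"
    proof (rule right_derivative_nonpos_imp_le[OF _ _ t])
      show "continuous_on {0..} (\<lambda>r. (norm (y r))\<^sup>2)"
        by (intro continuous_intros y_cont)
      fix r :: real assume r: "r \<ge> 0"
      let ?Dy = "A (S r v) - A (T r v)"
      have "((\<lambda>s. (S (r + s) v - S r v) /\<^sub>R s - (T (r + s) v - T r v) /\<^sub>R s) \<longlongrightarrow> ?Dy) (at_right 0)"
        by (intro tendsto_diff generates_on_orbit(2)[OF H S v r] generates_on_orbit(2)[OF H T v r])
      moreover have "(S (r + s) v - S r v) /\<^sub>R s - (T (r + s) v - T r v) /\<^sub>R s = (y (r + s) - y r) /\<^sub>R s" for s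
        unfolding y_def scaleR_diff_right[symmetric] by (rule arg_cong[of _ _ "scaleR (inverse s)"]) simp
      ultimately have dy: "((\<lambda>s. (y (r + s) - y r) /\<^sub>R s) \<longlongrightarrow> ?Dy) (at_right 0)"
        by simp
      have "(y \<longlongrightarrow> y r) (at r within {0..})"
        using y_cont r by (simp add: continuous_on_def)
      then have "(y \<longlongrightarrow> y r) (at_right r)"
        by (rule tendsto_within_subset) (use r in auto)
      then have "((\<lambda>s. y (r + s)) \<longlongrightarrow> y r) (at_right 0)"
        by (subst (asm) filterlim_at_right_to_0) (simp add: add.commute)
      with dy have "((\<lambda>s. inner ((y (r + s) - y r) /\<^sub>R s) (y (r + s) + y r)) \<longlongrightarrow>
          inner ?Dy (y r + y r)) (at_right 0)"
        by (intro tendsto_intros)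
      moreover have "inner ((y (r + s) - y r) /\<^sub>R s) (y (r + s) + y r) =
          ((norm (y (r + s)))\<^sup>2 - (norm (y r))\<^sup>2) / s" for s
        by (simp add: power2_norm_eq_inner inner_diff_left inner_add_right inner_commute[of "y r" "y (r + s)"]
            divide_inverse algebra_simps)
      moreover have "inner ?Dy (y r + y r) \<le> 0"
        using dissipative[OF generates_on_orbit(1)[OF H S v r] generates_on_orbit(1)[OF H T v r]]
        by (simp add: y_def inner_add_right)
      ultimately show "\<exists>d\<le>0. ((\<lambda>s. ((norm (y (r + s)))\<^sup>2 - (norm (y r))\<^sup>2) / s) \<longlongrightarrow> d) (at_right 0)"
        by auto
    qed
    moreover have "y 0 = 0"
      using C0[THEN C0_semigroup_onD(5)[OF _ t vH]] by (simp add: y_def)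
    ultimately show ?thesis by (simp add: y_def)
  qed
  obtain v where v: "\<And>n. v n \<in> D" "v \<longlonglongrightarrow> u"
    using u dense closure_sequential[of u D] by blast
  have lim: "(\<lambda>n. R t (v n)) \<longlonglongrightarrow> R t u" if "C0_semigroup_on H R" for R
    using v(1) H(2) by (intro C0_semigroup_on_tendsto[OF H(1) that t _ u v(2)] always_eventually) auto
  show ?thesis
    using LIMSEQ_unique[OF lim[OF C0(1)], of "T t u"] lim[OF C0(2)] on_D v(1) by simp
qed

lemma exp_op_eq:
  fixes A :: "'a::real_inner \<Rightarrow> 'a"
  assumes "subspace H" "D \<subseteq> H" "A ` D \<subseteq> H" "H \<subseteq> closure D"
    and "\<And>v w. v \<in> D \<Longrightarrow> w \<in> D \<Longrightarrow> inner (A v - A w) (v - w) \<le> 0"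
    and "generates_on H D A S" and "u \<in> H" and "t \<ge> 0"
  shows "exp_op H D A t u = S t u"
proof (rule generates_on_dissipative_unique[OF assms(1-5) _ assms(6-8)])
  show "generates_on H D A (exp_op H D A)"
    unfolding exp_op_def by (rule someI[where P = "generates_on H D A", OF assms(6)])
qed

section \<open>The generator of a multiplication semigroup and the limit covariance\<close>

lemma L2_cases:
  obtains r where "square_integrable r" "u = abs_L2 r"
  using square_integrable_rep_L2[of u] abs_rep_L2[of u] that by metis

lemma square_integrable_cong_AE:
  assumes "square_integrable u" "v \<in> borel_measurable borel" "AE x in lborel. u x = v x"
  shows "square_integrable v"
proof -
  have "integrable lborel (\<lambda>x. (u x)\<^sup>2) \<longleftrightarrow> integrable lborel (\<lambda>x. (v x)\<^sup>2)"
    using assms by (intro integrable_cong_AE) (auto simp: square_integrable_def)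
  then show ?thesis using assms by (simp add: square_integrable_def)
qed

lemma subspace_L2_on: "subspace (L2_on X)"
proof (rule subspaceI)
  show "0 \<in> L2_on X"
    unfolding zero_L2_def by (subst map_fun_apply abs_L2_in_L2_on) (auto simp: square_integrable_zero)
  show "u + v \<in> L2_on X" if "u \<in> L2_on X" "v \<in> L2_on X" for u v
    using that
    by (cases u rule: L2_cases; cases v rule: L2_cases)
       (auto simp: add_abs_L2 abs_L2_in_L2_on square_integrable_add)
  show "c *\<^sub>R u \<in> L2_on X" if "u \<in> L2_on X" for c u
    using that by (cases u rule: L2_cases) (auto simp: scaleR_abs_L2 abs_L2_in_L2_on square_integrable_scale)
qed

context
  fixes X :: "real set" and h k :: "real \<Rightarrow> real"
  defines "k \<equiv> (\<lambda>x. indicator X x * h x)"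
  assumes k_meas [measurable]: "k \<in> borel_measurable borel"
    and h_nonpos: "\<And>x. x \<in> X \<Longrightarrow> h x \<le> 0"
begin

lemma k_le_0: "k x \<le> 0"
  using h_nonpos by (auto simp: k_def indicator_def)

lemma k_mult_rep:
  assumes "square_integrable r"
  shows "AE x in lborel. k x * rep_L2 (abs_L2 r) x = k x * r x"
  using rep_abs_L2[OF assms] by eventually_elim simp

lemma mult_dom_abs:
  assumes "square_integrable r"
  shows "abs_L2 r \<in> mult_dom X h \<longleftrightarrow> abs_L2 r \<in> L2_on X \<and> square_integrable (\<lambda>x. k x * r x)"
proof -
  have [measurable]: "r \<in> borel_measurable borel" "rep_L2 (abs_L2 r) \<in> borel_measurable borel"
    using assms square_integrable_rep_L2 square_integrable_measurable by auto
  have "square_integrable (\<lambda>x. k x * rep_L2 (abs_L2 r) x) \<longleftrightarrow> square_integrable (\<lambda>x. k x * r x)"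
  proof
    assume "square_integrable (\<lambda>x. k x * rep_L2 (abs_L2 r) x)"
    then show "square_integrable (\<lambda>x. k x * r x)"
      by (rule square_integrable_cong_AE) (use k_mult_rep[OF assms] in auto)
  next
    assume "square_integrable (\<lambda>x. k x * r x)"
    then show "square_integrable (\<lambda>x. k x * rep_L2 (abs_L2 r) x)"
      by (rule square_integrable_cong_AE) (use k_mult_rep[OF assms] in auto)
  qed
  then show ?thesis by (simp add: mult_dom_def k_def mult.assoc)
qed

lemma mult_op_abs:
  assumes "square_integrable r" "square_integrable (\<lambda>x. k x * r x)"
  shows "mult_op X h (abs_L2 r) = abs_L2 (\<lambda>x. k x * r x)"
proof -
  have [measurable]: "rep_L2 (abs_L2 r) \<in> borel_measurable borel"
    using square_integrable_rep_L2 square_integrable_measurable by auto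
  have "square_integrable (\<lambda>x. k x * rep_L2 (abs_L2 r) x)"
    by (rule square_integrable_cong_AE[OF assms(2)]) (use k_mult_rep[OF assms(1)] in auto)
  then have "abs_L2 (\<lambda>x. k x * rep_L2 (abs_L2 r) x) = abs_L2 (\<lambda>x. k x * r x)"
    using k_mult_rep[OF assms(1)] assms by (subst abs_L2_eq_iff) auto
  then show ?thesis by (simp add: mult_op_def k_def mult.assoc)
qed

lemma mult_dom_cases:
  assumes "u \<in> mult_dom X h"
  obtains r where "square_integrable r" "square_integrable (\<lambda>x. k x * r x)" "u = abs_L2 r"
    "abs_L2 r \<in> L2_on X"
  using assms mult_dom_abs by (cases u rule: L2_cases) auto

lemma mult_op_in_L2_on: "u \<in> mult_dom X h \<Longrightarrow> mult_op X h u \<in> L2_on X"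
  by (erule mult_dom_cases) (simp add: mult_op_abs abs_L2_in_L2_on k_def)

lemma mult_op_dissipative:
  assumes "u \<in> mult_dom X h" "v \<in> mult_dom X h"
  shows "inner (mult_op X h u - mult_op X h v) (u - v) \<le> 0"
proof -
  obtain r where r: "square_integrable r" "square_integrable (\<lambda>x. k x * r x)" "u = abs_L2 r"
    using assms(1) by (rule mult_dom_cases)
  obtain q where q: "square_integrable q" "square_integrable (\<lambda>x. k x * q x)" "v = abs_L2 q"
    using assms(2) by (rule mult_dom_cases)
  have "inner (mult_op X h u - mult_op X h v) (u - v) =
      (LINT x|lborel. (k x * r x - k x * q x) * (r x - q x))"
    using r q by (simp add: mult_op_abs diff_abs_L2 inner_abs_L2 square_integrable_diff)
  also have "\<dots> = - (LINT x|lborel. - ((k x * r x - k x * q x) * (r x - q x)))"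
    by simp
  also have "\<dots> \<le> 0"
  proof (subst neg_le_0_iff_le, rule Bochner_Integration.integral_nonneg)
    fix x
    have "(k x * r x - k x * q x) * (r x - q x) = k x * (r x - q x)\<^sup>2"
      by (simp add: power2_eq_square algebra_simps)
    then show "0 \<le> - ((k x * r x - k x * q x) * (r x - q x))"
      using k_le_0[of x] by (simp add: mult_nonpos_nonneg)
  qed
  finally show ?thesis .
qed

text \<open>Cutting off where \<open>\<bar>k\<bar> > n\<close> produces elements of the domain.\<close>

lemma mult_dom_dense: "L2_on X \<subseteq> closure (mult_dom X h)"
proof
  fix u assume u: "u \<in> L2_on X"
  obtain r where r: "square_integrable r" "u = abs_L2 r" by (rule L2_cases)
  have [measurable]: "r \<in> borel_measurable borel" using r(1) by (rule square_integrable_measurable)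
  define v where "v n x = indicator {x. \<bar>k x\<bar> \<le> real n} x * r x" for n x
  have v_meas [measurable]: "v n \<in> borel_measurable borel" for n unfolding v_def by measurable
  have v_le: "\<bar>v n x\<bar> \<le> \<bar>r x\<bar>" for n x by (simp add: v_def indicator_def)
  have v: "square_integrable (v n)" for n
    by (rule square_integrable_bound[OF r(1) v_meas v_le])
  have "abs_L2 (v n) \<in> mult_dom X h" for n
  proof -
    have "square_integrable (\<lambda>x. k x * v n x)"
    proof (rule square_integrable_bound[OF square_integrable_scale[OF r(1), of "real n"]])
      show "\<bar>k x * v n x\<bar> \<le> \<bar>real n * r x\<bar>" for x
        by (auto simp: v_def indicator_def abs_mult intro: mult_right_mono)
    qed measurable
    moreover have "abs_L2 (v n) \<in> L2_on X"
      using u r v by (auto simp: abs_L2_in_L2_on v_def)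
    ultimately show ?thesis using v by (simp add: mult_dom_abs)
  qed
  moreover have "(\<lambda>n. abs_L2 (v n)) \<longlonglongrightarrow> u"
    unfolding r(2)
  proof (rule L2_dominated_convergence_sequentially[OF r(1) v_meas v_le])
    fix x
    have "\<forall>\<^sub>F n in sequentially. v n x = r x"
      using eventually_ge_at_top[of "nat \<lceil>\<bar>k x\<bar>\<rceil>"]
      by eventually_elim (simp add: v_def indicator_def nat_le_iff ceiling_le_iff)
    then show "(\<lambda>n. v n x) \<longlonglongrightarrow> r x" by (rule tendsto_eventually)
  qed
  ultimately show "u \<in> closure (mult_dom X h)"
    by (auto simp: closure_sequential intro!: exI[of _ "\<lambda>n. abs_L2 (v n)"])
qed

lemma mult_semigroup_C0: "C0_semigroup_on (L2_on X) (mult_semigroup k)"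
  unfolding C0_semigroup_on_def
proof (intro conjI allI ballI impI)
  note sg = mult_semigroup_abs[OF k_meas k_le_0] square_integrable_exp_mult[OF k_meas k_le_0]
  fix t :: real and u v :: L2 assume t: "t \<ge> 0" and u: "u \<in> L2_on X"
  obtain r where r: "square_integrable r" "u = abs_L2 r" by (rule L2_cases)
  show "mult_semigroup k t u \<in> L2_on X"
    using u r t by (auto simp: sg abs_L2_in_L2_on)
  show "mult_semigroup k t (u + v) = mult_semigroup k t u + mult_semigroup k t v"
  proof -
    obtain q where q: "square_integrable q" "v = abs_L2 q" by (rule L2_cases)
    show ?thesis using r q t by (simp add: sg add_abs_L2 square_integrable_add distrib_left)
  qed
  show "mult_semigroup k t (c *\<^sub>R u) = c *\<^sub>R mult_semigroup k t u" for c
    using r t by (simp add: sg scaleR_abs_L2 square_integrable_scale mult.left_commute)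
  show "mult_semigroup k (s + t) u = mult_semigroup k s (mult_semigroup k t u)" if "s \<ge> 0" for s
    using r t that by (simp add: sg distrib_right exp_add mult.assoc)
next
  fix u assume "u \<in> L2_on X"
  show "mult_semigroup k 0 u = u"
    by (simp add: mult_semigroup_def abs_rep_L2)
next
  fix t :: real assume "t \<ge> 0"
  then show "\<exists>C. \<forall>u\<in>L2_on X. norm (mult_semigroup k t u) \<le> C * norm u"
    using norm_mult_semigroup_le[OF k_meas k_le_0, of t 0] k_le_0 by (intro exI[of _ 1]) simp
next
  fix u assume "u \<in> L2_on X"
  obtain r where r: "square_integrable r" "u = abs_L2 r" by (rule L2_cases)
  have [measurable]: "r \<in> borel_measurable borel" using r(1) by (rule square_integrable_measurable)
  have "continuous_on {0..} (\<lambda>t. abs_L2 (\<lambda>x. exp (t * k x) * r x))"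
    unfolding continuous_on_def
  proof (intro ballI L2_dominated_convergence[OF r(1)])
    show "\<bar>exp (s * k x) * r x\<bar> \<le> \<bar>r x\<bar>" if "s \<in> {0..} - {t}" for s t x
      using that exp_k_le_1[OF k_meas k_le_0, of s x] by (auto simp: abs_mult mult_left_le_one_le)
  qed (auto intro!: tendsto_intros)
  moreover have "continuous_on {0..} (\<lambda>t. mult_semigroup k t u) \<longleftrightarrow>
      continuous_on {0..} (\<lambda>t. abs_L2 (\<lambda>x. exp (t * k x) * r x))"
    using r by (intro continuous_on_cong) (simp_all add: mult_semigroup_abs[OF k_meas k_le_0])
  ultimately show "continuous_on {0..} (\<lambda>t. mult_semigroup k t u)"
    by simp
qed

text \<open>
  If the difference quotients at time \<open>0\<close> converge in mean square, the limit has to be their pointwise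
  limit \<open>k * u\<close>; so \<open>k * u\<close> is square-integrable, and the generator is defined on no more than the
  maximal domain. The converse is the derivative of the orbit at time \<open>0\<close>.
\<close>

lemma mult_semigroup_generates:
  "generates_on (L2_on X) (mult_dom X h) (mult_op X h) (mult_semigroup k)"
  unfolding generates_on_def
proof (intro conjI mult_semigroup_C0 ballI iffI)
  note sg = mult_semigroup_abs[OF k_meas k_le_0] square_integrable_exp_mult[OF k_meas k_le_0]
  fix u w assume u: "u \<in> L2_on X"
  obtain r where r: "square_integrable r" "u = abs_L2 r" by (rule L2_cases)
  have [measurable]: "r \<in> borel_measurable borel" using r(1) by (rule square_integrable_measurable)
  assume lim: "((\<lambda>s. (mult_semigroup k s u - u) /\<^sub>R s) \<longlongrightarrow> w) (at_right 0)"
  obtain q where q: "square_integrable q" "w = abs_L2 q" by (rule L2_cases)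
  define s where "s n = inverse (real (Suc n))" for n
  have s: "s n > 0" "s \<longlonglongrightarrow> 0" for n
    unfolding s_def by (simp, rule LIMSEQ_inverse_real_of_nat)
  define v where "v n x = inverse (s n) * (exp (s n * k x) * r x - r x)" for n x
  have v: "square_integrable (v n)" for n
    using s(1)[of n] r unfolding v_def
    by (intro square_integrable_scale square_integrable_diff sg(2)) auto
  have "(mult_semigroup k (s n) u - u) /\<^sub>R s n = abs_L2 (v n)" for n
    using s(1)[of n] r unfolding v_def
    by (simp add: sg diff_abs_L2 scaleR_abs_L2 square_integrable_diff)
  moreover have "(\<lambda>n. (mult_semigroup k (s n) u - u) /\<^sub>R s n) \<longlonglongrightarrow> w"
    using lim s unfolding tendsto_at_iff_sequentially comp_def by auto
  ultimately have "(\<lambda>n. abs_L2 (v n)) \<longlonglongrightarrow> abs_L2 q"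
    using q(2) by simp
  moreover have "(\<lambda>n. v n x) \<longlonglongrightarrow> k x * r x" for x
  proof -
    have "((\<lambda>s. exp (s * k x)) has_field_derivative k x) (at 0)"
      by (auto intro!: derivative_eq_intros)
    then have "((\<lambda>s. (exp (s * k x) - 1) / s) \<longlongrightarrow> k x) (at 0)"
      by (simp add: has_field_derivative_iff)
    then have "(\<lambda>n. (exp (s n * k x) - 1) / s n) \<longlonglongrightarrow> k x"
      using s unfolding tendsto_at_iff_sequentially comp_def by (metis DiffI UNIV_I less_irrefl singletonD)
    from tendsto_mult_right[OF this, of "r x"] show ?thesis
      by (simp add: v_def divide_inverse algebra_simps)
  qed
  ultimately have ae: "AE x in lborel. k x * r x = q x"
    by (rule abs_L2_limit_unique_pointwise[OF v q(1)])
  then have kr: "square_integrable (\<lambda>x. k x * r x)"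
    by (intro square_integrable_cong_AE[OF q(1)]) (auto simp: eq_commute)
  then show "u \<in> mult_dom X h"
    using u r by (simp add: mult_dom_abs)
  show "w = mult_op X h u"
    using ae kr q r by (simp add: mult_op_abs abs_L2_eq_iff eq_commute)
next
  fix u w assume "u \<in> L2_on X" "u \<in> mult_dom X h \<and> w = mult_op X h u"
  then obtain r where r: "square_integrable r" "square_integrable (\<lambda>x. k x * r x)" "u = abs_L2 r"
      and w: "w = abs_L2 (\<lambda>x. k x * r x)"
    by (metis mult_dom_cases mult_op_abs)
  have "at (0::real) within {0..} = at_right 0"
    unfolding at_within_def by (rule arg_cong[of _ _ "\<lambda>A. inf (nhds 0) (principal A)"]) auto
  then show "((\<lambda>s. (mult_semigroup k s u - u) /\<^sub>R s) \<longlongrightarrow> w) (at_right 0)"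
    using has_vector_derivative_mult_semigroup[OF k_meas k_le_0 r(1,2) order_refl] r w
    by (simp add: has_vector_derivative_iff_quotient mult_semigroup_abs[OF k_meas k_le_0])
qed

theorem exp_mult_eq_mult_semigroup:
  assumes "u \<in> L2_on X" "t \<ge> 0"
  shows "exp_mult X h t u = mult_semigroup k t u"
  unfolding exp_mult_def
proof (rule exp_op_eq[OF subspace_L2_on _ _ mult_dom_dense mult_op_dissipative
      mult_semigroup_generates assms])
  show "mult_dom X h \<subseteq> L2_on X" by (auto simp: mult_dom_def)
qed (auto intro: mult_op_in_L2_on)

text \<open>
  Let \<open>w = u / (2 * k)\<close>. As \<open>k \<le> p < 0\<close> on \<open>X\<close>, \<open>w\<close> is square-integrable, and \<open>k * w = u / 2\<close> puts it
  into the domain of the generator. So \<open>mult_semigroup k (2 * s)\<close> applied to \<open>w\<close> is a primitive of the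
  integrand, and it decays like \<open>exp (2 * p * s)\<close>; the value at \<open>s = 0\<close> is all that remains.
  Outside \<open>X\<close>, where \<open>k = 0\<close>, division by zero makes both sides vanish.
\<close>

theorem cov_inf_eq:
  assumes h_neg: "\<And>x. x \<in> X \<Longrightarrow> h x \<le> p" "p < 0" and u: "square_integrable u" "abs_L2 u \<in> L2_on X"
  shows "square_integrable (\<lambda>x. \<sigma>\<^sup>2 / (2 * \<bar>k x\<bar>) * u x)"
    and "cov_inf X h \<sigma> id (abs_L2 u) = abs_L2 (\<lambda>x. \<sigma>\<^sup>2 / (2 * \<bar>k x\<bar>) * u x)"
proof -
  note sg = mult_semigroup_abs[OF k_meas k_le_0] square_integrable_exp_mult[OF k_meas k_le_0]
  have [measurable]: "u \<in> borel_measurable borel" using u(1) by (rule square_integrable_measurable)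
  define w where "w x = u x / (2 * k x)" for x
  have [measurable]: "w \<in> borel_measurable borel" unfolding w_def by measurable
  have k_p: "k x \<le> p" if "x \<in> X" for x using h_neg that by (simp add: k_def)
  have u0: "AE x in lborel. x \<notin> X \<longrightarrow> u x = 0" using u by (simp add: abs_L2_in_L2_on)
  have w: "square_integrable w"
  proof (rule square_integrable_bound[OF square_integrable_scale[OF u(1), of "1 / (2 * p)"]])
    fix x
    show "\<bar>w x\<bar> \<le> \<bar>1 / (2 * p) * u x\<bar>"
    proof (cases "x \<in> X")
      case True
      then show ?thesis
        using k_p[OF True] h_neg(2) by (auto simp: w_def abs_mult intro!: divide_left_mono mult_neg_neg)
    qed (simp add: w_def k_def)
  qed measurable
  have kw: "AE x in lborel. k x * w x = u x / 2"
    using u0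
  proof eventually_elim
    case (elim x)
    then show ?case using k_p[of x] h_neg(2) by (cases "x \<in> X") (auto simp: w_def)
  qed
  have kw_sq: "square_integrable (\<lambda>x. k x * w x)"
    using kw by (intro square_integrable_cong_AE[OF square_integrable_scale[OF u(1), of "1/2"]])
      (auto simp: eq_commute)
  have kw_abs: "abs_L2 (\<lambda>x. k x * w x) = (1/2) *\<^sub>R abs_L2 u"
    using kw kw_sq square_integrable_scale[OF u(1), of "1/2"]
    by (simp add: scaleR_abs_L2[OF u(1)] abs_L2_eq_iff)
  have int: "((\<lambda>s. exp_mult X h s (id (exp_mult X h s (abs_L2 u)))) has_integral
      (mult_semigroup k (2 * t) (abs_L2 w) - abs_L2 w)) {0..t}" if t: "t \<ge> 0" for t
  proof -
    have "((\<lambda>s. mult_semigroup k (2 * s) (abs_L2 u)) has_integral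
        (mult_semigroup k (2 * t) (abs_L2 w) - mult_semigroup k (2 * 0) (abs_L2 w))) {0..t}"
    proof (rule fundamental_theorem_of_calculus[OF t])
      fix s assume s: "s \<in> {0..t}"
      have "((\<lambda>s. 2 * s) has_vector_derivative 2) (at s within {0..t})"
        by (auto intro!: derivative_eq_intros)
      moreover have "((\<lambda>s. mult_semigroup k s (abs_L2 w)) has_vector_derivative
          mult_semigroup k (2 * s) (abs_L2 (\<lambda>x. k x * w x))) (at (2 * s) within (*) 2 ` {0..t})"
        by (rule has_vector_derivative_within_subset
            [OF has_vector_derivative_mult_semigroup[OF k_meas k_le_0 w kw_sq]]) (use s in auto)
      ultimately have "((\<lambda>s. mult_semigroup k s (abs_L2 w)) \<circ> (*) 2 has_vector_derivative
          2 *\<^sub>R mult_semigroup k (2 * s) (abs_L2 (\<lambda>x. k x * w x))) (at s within {0..t})"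
        by (rule vector_diff_chain_within)
      moreover have "2 *\<^sub>R mult_semigroup k (2 * s) (abs_L2 (\<lambda>x. k x * w x)) =
          mult_semigroup k (2 * s) (abs_L2 u)"
        using s C0_semigroup_onD(2)[OF mult_semigroup_C0 _ u(2), of "2 * s" "1/2"] by (simp add: kw_abs)
      ultimately show "((\<lambda>s. mult_semigroup k (2 * s) (abs_L2 w)) has_vector_derivative
          mult_semigroup k (2 * s) (abs_L2 u)) (at s within {0..t})"
        by (simp add: comp_def)
    qed
    then have *: "((\<lambda>s. mult_semigroup k (2 * s) (abs_L2 u)) has_integral
        (mult_semigroup k (2 * t) (abs_L2 w) - abs_L2 w)) {0..t}"
      using w by (simp add: sg)
    show ?thesis
    proof (rule has_integral_eq[OF _ *])
      fix s assume "s \<in> {0..t}"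
      then have s: "s \<ge> 0" by simp
      have "mult_semigroup k s (mult_semigroup k s (abs_L2 u)) = mult_semigroup k (2 * s) (abs_L2 u)"
        using C0_semigroup_onD(4)[OF mult_semigroup_C0 s u(2) s] by (simp flip: mult_2)
      then show "mult_semigroup k (2 * s) (abs_L2 u) = exp_mult X h s (id (exp_mult X h s (abs_L2 u)))"
        using C0_semigroup_onD(1)[OF mult_semigroup_C0 s u(2)] s u
        by (simp add: exp_mult_eq_mult_semigroup)
    qed
  qed
  have lim: "((\<lambda>t. mult_semigroup k (2 * t) (abs_L2 w)) \<longlongrightarrow> 0) at_top"
  proof (rule Lim_null_comparison)
    have "AE x in lborel. k x \<le> p \<or> rep_L2 (abs_L2 w) x = 0"
      using rep_abs_L2[OF w] u0 by eventually_elim (use k_p in \<open>auto simp: w_def\<close>)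
    then show "\<forall>\<^sub>F t in at_top. norm (mult_semigroup k (2 * t) (abs_L2 w)) \<le> exp (2 * t * p) * norm (abs_L2 w)"
      using h_neg by (intro eventually_mono[OF eventually_ge_at_top[of 0]] norm_mult_semigroup_le k_meas k_le_0) auto
    have "((\<lambda>t. exp (2 * t * p)) \<longlongrightarrow> 0) at_top"
      using h_neg by real_asymp
    then show "((\<lambda>t. exp (2 * t * p) * norm (abs_L2 w)) \<longlongrightarrow> 0) at_top"
      by (rule tendsto_mult_left_zero)
  qed
  have "((\<lambda>t. cov_op X h \<sigma> id t (abs_L2 u)) \<longlongrightarrow> \<sigma>\<^sup>2 *\<^sub>R (0 - abs_L2 w)) at_top"
  proof (rule Lim_transform_eventually)
    show "((\<lambda>t. \<sigma>\<^sup>2 *\<^sub>R (mult_semigroup k (2 * t) (abs_L2 w) - abs_L2 w)) \<longlongrightarrow> \<sigma>\<^sup>2 *\<^sub>R (0 - abs_L2 w)) at_top"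
      by (intro tendsto_intros lim)
    show "\<forall>\<^sub>F t in at_top. \<sigma>\<^sup>2 *\<^sub>R (mult_semigroup k (2 * t) (abs_L2 w) - abs_L2 w) = cov_op X h \<sigma> id t (abs_L2 u)"
      using eventually_ge_at_top[of 0]
    proof eventually_elim
      case (elim t)
      show ?case unfolding cov_op_def using integral_unique[OF int[OF elim]] by simp
    qed
  qed
  then have "cov_inf X h \<sigma> id (abs_L2 u) = \<sigma>\<^sup>2 *\<^sub>R (0 - abs_L2 w)"
    unfolding cov_inf_def by (rule tendsto_Lim[rotated]) simp
  also have "\<dots> = abs_L2 (\<lambda>x. (- \<sigma>\<^sup>2) * w x)"
    unfolding scaleR_abs_L2[OF w, symmetric] by simp
  finally have *: "cov_inf X h \<sigma> id (abs_L2 u) = abs_L2 (\<lambda>x. (- \<sigma>\<^sup>2) * w x)" .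
  have eq: "(\<lambda>x. (- \<sigma>\<^sup>2) * w x) = (\<lambda>x. \<sigma>\<^sup>2 / (2 * \<bar>k x\<bar>) * u x)"
    using k_le_0 by (simp add: fun_eq_iff w_def abs_of_nonpos)
  show "square_integrable (\<lambda>x. \<sigma>\<^sup>2 / (2 * \<bar>k x\<bar>) * u x)"
    using square_integrable_scale[OF w, of "- \<sigma>\<^sup>2"] unfolding eq .
  show "cov_inf X h \<sigma> id (abs_L2 u) = abs_L2 (\<lambda>x. \<sigma>\<^sup>2 / (2 * \<bar>k x\<bar>) * u x)"
    using * unfolding eq .
qed

end

section \<open>Power series on a closed interval of convergence\<close>

text \<open>
  Summation by parts writes the weighted sum as a sum of the partial sums of \<open>b\<close> with the nonnegative
  weights \<open>t ^ k - t ^ Suc k\<close> and \<open>t ^ n\<close>, which add up to \<open>1\<close>.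
\<close>

lemma abel_partial_sum_bound:
  fixes b :: "nat \<Rightarrow> real"
  assumes b: "\<And>n. \<bar>\<Sum>k<n. b k\<bar> \<le> e" and t: "0 \<le> t" "t \<le> 1"
  shows "\<bar>\<Sum>k<n. b k * t ^ k\<bar> \<le> e"
proof -
  define s where "s n = (\<Sum>k<n. b k)" for n
  have "(\<Sum>k<n. b k * t ^ k) = (\<Sum>k<n. s (Suc k) * (t ^ k - t ^ Suc k)) + s n * t ^ n"
    by (induction n) (simp_all add: s_def algebra_simps)
  also have "\<bar>\<dots>\<bar> \<le> (\<Sum>k<n. \<bar>s (Suc k) * (t ^ k - t ^ Suc k)\<bar>) + \<bar>s n * t ^ n\<bar>"
    by (intro order_trans[OF abs_triangle_ineq] add_right_mono sum_abs)
  also have "\<dots> \<le> (\<Sum>k<n. e * (t ^ k - t ^ Suc k)) + e * t ^ n"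
  proof (intro add_mono sum_mono)
    fix k
    have "t ^ Suc k \<le> t ^ k" using t by (simp add: mult_left_le_one_le)
    then show "\<bar>s (Suc k) * (t ^ k - t ^ Suc k)\<bar> \<le> e * (t ^ k - t ^ Suc k)"
      using b[of "Suc k"] by (simp add: abs_mult s_def mult_right_mono del: power_Suc sum.lessThan_Suc)
    show "\<bar>s n * t ^ n\<bar> \<le> e * t ^ n"
      using b[of n] t by (simp add: abs_mult s_def mult_right_mono)
  qed
  also have "\<dots> = e"
    by (simp only: sum_distrib_left[symmetric] sum_lessThan_telescope' power_0) (simp add: algebra_simps)
  finally show ?thesis .
qed

text \<open>
  By the bound on weighted sums, applied to the tails of \<open>b\<close>, the power series converges uniformly up
  to and including the end point \<open>1\<close>.
\<close>

lemma continuous_on_powser_unit_interval: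
  fixes b :: "nat \<Rightarrow> real"
  assumes "summable b"
  shows "continuous_on {0..1} (\<lambda>t. \<Sum>k. b k * t ^ k)"
proof -
  let ?S = "\<lambda>n t. \<Sum>k<n. b k * t ^ k"
  have "uniformly_Cauchy_on {0..1} ?S"
    unfolding uniformly_Cauchy_on_def
  proof (intro allI impI)
    fix e :: real assume e: "e > 0"
    then obtain N where N: "\<And>m n. m \<ge> N \<Longrightarrow> norm (sum b {m..<n}) < e / 2"
      using assms unfolding summable_Cauchy by (meson half_gt_zero)
    have *: "dist (?S m t) (?S n t) < e" if "t \<in> {0..1}" "N \<le> m" "m \<le> n" for t m n
    proof -
      have shift: "sum g {m..<m + j} = (\<Sum>k<j. g (m + k))" for g :: "nat \<Rightarrow> real" and j
        by (simp add: sum.atLeastLessThan_shift_0[of g m] atLeast0LessThan comp_def)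
      have "?S n t - ?S m t = (\<Sum>k\<in>{m..<m + (n - m)}. b k * t ^ k)"
        using that(3) by (simp add: sum_diff_nat_ivl[of 0 m n, symmetric] atLeast0LessThan[symmetric])
      also have "\<dots> = t ^ m * (\<Sum>k<n - m. b (m + k) * t ^ k)"
        unfolding shift by (simp add: sum_distrib_left power_add mult_ac)
      finally have "\<bar>?S n t - ?S m t\<bar> = t ^ m * \<bar>\<Sum>k<n - m. b (m + k) * t ^ k\<bar>"
        using that(1) by (simp add: abs_mult)
      also have "\<dots> \<le> 1 * (e / 2)"
      proof (intro mult_mono abel_partial_sum_bound)
        show "\<bar>\<Sum>k<j. b (m + k)\<bar> \<le> e / 2" for j
          using N[OF that(2), of "m + j"] unfolding shift by simp
      qed (use that(1) in \<open>auto simp: power_le_one\<close>)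
      finally show ?thesis using e by (simp add: dist_real_def abs_minus_commute)
    qed
    show "\<exists>M. \<forall>t\<in>{0..1}. \<forall>m\<ge>M. \<forall>n\<ge>M. dist (?S m t) (?S n t) < e"
    proof (intro exI[of _ N] ballI allI impI)
      fix t :: real and m n assume "t \<in> {0..1}" "N \<le> m" "N \<le> n"
      then show "dist (?S m t) (?S n t) < e"
        using *[of t m n] *[of t n m] by (cases "m \<le> n") (auto simp: dist_commute)
    qed
  qed
  then have "uniform_limit {0..1} ?S (\<lambda>t. lim (\<lambda>n. ?S n t)) sequentially"
    by (simp add: Cauchy_uniformly_convergent uniformly_convergent_uniform_limit_iff[symmetric])
  then have "uniform_limit {0..1} ?S (\<lambda>t. \<Sum>k. b k * t ^ k) sequentially"
    by (simp add: suminf_eq_lim)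
  then show ?thesis
    by (rule uniform_limit_theorem[rotated]) (auto intro!: always_eventually continuous_intros)
qed

theorem Abel_continuous_on_powser:
  fixes c :: "nat \<Rightarrow> real"
  assumes "\<epsilon> > 0" "summable (\<lambda>n. c n * \<epsilon> ^ n)"
  shows "continuous_on {0..\<epsilon>} (\<lambda>x. \<Sum>n. c n * x ^ n)"
proof -
  have "continuous_on {0..\<epsilon>} ((\<lambda>t. \<Sum>n. (c n * \<epsilon> ^ n) * t ^ n) \<circ> (\<lambda>x. x / \<epsilon>))"
    using assms
    by (intro continuous_on_compose continuous_on_subset[OF continuous_on_powser_unit_interval[OF assms(2)]])
       (auto intro!: continuous_intros)
  then show ?thesis
    using assms(1) by (simp add: comp_def power_divide)
qed

section \<open>Asymptotics of the scalar integral\<close>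

lemma Theta_left0I:
  assumes b2: "\<forall>\<^sub>F p in at_left 0. b2 p > 0" and L: "L > 0"
    and lim: "((\<lambda>p. b1 p / b2 p) \<longlongrightarrow> L) (at_left 0)"
  shows "Theta_left0 b1 b2"
  unfolding Theta_left0_def
proof (intro conjI b2)
  have "\<forall>\<^sub>F p in at_left 0. b1 p / b2 p > 0"
    by (rule order_tendstoD(1)[OF lim L])
  with b2 show "\<forall>\<^sub>F p in at_left 0. b1 p > 0"
    by eventually_elim (simp add: zero_less_divide_iff)
  show "\<exists>L>0. ((\<lambda>p. b1 p / b2 p) \<longlongrightarrow> L) (at_left 0)" using L lim by blast
  have "((\<lambda>p. inverse (b1 p / b2 p)) \<longlongrightarrow> inverse L) (at_left 0)"
    using L by (intro tendsto_inverse lim) simp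
  then show "\<exists>L>0. ((\<lambda>p. b2 p / b1 p) \<longlongrightarrow> L) (at_left 0)"
    using L by (intro exI[of _ "inverse L"]) simp
qed

lemma integrable_inverse_square_tail:
  "integrable lborel (\<lambda>y::real. indicator {1..} y * (1 / y\<^sup>2))"
proof -
  have "(\<integral>\<^sup>+y. ennreal (1 / y\<^sup>2) * indicator {1..} y \<partial>lborel) = ennreal (0 - (- 1 / 1))"
  proof (rule nn_integral_FTC_atLeast[where F = "\<lambda>y. - 1 / y"])
    show "((\<lambda>y::real. - 1 / y) has_real_derivative 1 / y\<^sup>2) (at y)" if "1 \<le> y" for y
      using that by (auto intro!: derivative_eq_intros simp: power2_eq_square)
    show "((\<lambda>y::real. - 1 / y) \<longlongrightarrow> 0) at_top" by real_asymp
  qed auto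
  then have "(\<integral>\<^sup>+y. ennreal (indicator {1..} y * (1 / y\<^sup>2)) \<partial>lborel) < \<infinity>"
    by (simp add: indicator_mult_ennreal mult.commute)
  then show ?thesis
    by (intro integrableI_nonneg) auto
qed

context
  fixes G :: "real \<Rightarrow> real" and \<epsilon> :: real
  assumes \<epsilon>: "\<epsilon> > 0" and G_cont: "continuous_on {0..\<epsilon>} G"
    and G_pos: "\<And>x. x \<in> {0..\<epsilon>} \<Longrightarrow> G x > 0"
begin

lemma G_lower_bound: obtains \<gamma> where "\<gamma> > 0" "\<And>x. x \<in> {0..\<epsilon>} \<Longrightarrow> G x \<ge> \<gamma>"
proof -
  obtain x0 where "x0 \<in> {0..\<epsilon>}" "\<And>x. x \<in> {0..\<epsilon>} \<Longrightarrow> G x0 \<le> G x"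
    using continuous_attains_inf[OF _ _ G_cont] \<epsilon> by auto
  then show ?thesis using that[of "G x0"] G_pos by blast
qed

lemma denominator_pos: "q > 0 \<Longrightarrow> x \<in> {0..\<epsilon>} \<Longrightarrow> x ^ m * G x + q > 0"
  using G_pos[of x] by (intro add_nonneg_pos mult_nonneg_nonneg) auto

lemma integrand_continuous:
  "q > 0 \<Longrightarrow> continuous_on {0..\<epsilon>} (\<lambda>x. 1 / (x ^ m * G x + q))"
  using denominator_pos by (intro continuous_intros G_cont) (metis less_irrefl)

text \<open>
  Scaling by \<open>c q = q powr (1 / m)\<close> balances the two terms of the denominator:
  \<open>(c q * y) ^ m * G (c q * y) + q = q * (y ^ m * G (c q * y) + 1)\<close>. The rescaled integrands \<open>K q\<close> tend to
  \<open>K0\<close>, as \<open>G (c q * y)\<close> tends to \<open>G 0\<close>. They are dominated because \<open>G\<close> is bounded below by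
  some \<open>\<gamma> > 0\<close>, which gives the bound \<open>1 / (\<gamma> * y\<^sup>2)\<close> for \<open>y \<ge> 1\<close>; this is where \<open>m \<ge> 2\<close> matters.
\<close>

theorem integral_asymptotics_power:
  assumes m: "m \<ge> (2::nat)"
  obtains L where "L > 0"
    "((\<lambda>q. (LINT x:{0..\<epsilon>}|lborel. 1 / (x ^ m * G x + q)) / q powr (-1 + 1 / real m)) \<longlongrightarrow> L) (at_right 0)"
proof -
  define c where "c q = q powr (1 / real m)" for q :: real
  define H where "H q x = indicator {0..\<epsilon>} x *\<^sub>R (1 / (x ^ m * G x + q))" for q x
  define K where "K q y = q * H q (c q * y)" for q y
  define K0 where "K0 y = indicator {0..} y * (1 / (y ^ m * G 0 + 1))" for y
  have c: "c q > 0" "c q ^ m = q" if "q > 0" for q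
    using that m by (simp_all add: c_def powr_power)
  have H_meas: "H q \<in> borel_measurable borel" if "q > 0" for q
    unfolding H_def
    using borel_measurable_continuous_on_indicator[OF _ integrand_continuous[OF that]] by simp
  have K_eq: "K q y = indicator {0..\<epsilon>} (c q * y) * (1 / (y ^ m * G (c q * y) + 1))" if "q > 0" for q y
  proof -
    have "(c q * y) ^ m * G (c q * y) + q = q * (y ^ m * G (c q * y) + 1)"
      using c[OF that] by (simp add: power_mult_distrib algebra_simps)
    then show ?thesis using that by (simp add: K_def H_def)
  qed
  have scaled: "(LINT x:{0..\<epsilon>}|lborel. 1 / (x ^ m * G x + q)) / q powr (-1 + 1 / real m) = (LINT y|lborel. K q y)"
    if q: "q > 0" for q
  proof -
    have "(LINT x:{0..\<epsilon>}|lborel. 1 / (x ^ m * G x + q)) = (LINT x|lborel. H q x)"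
      by (simp add: set_lebesgue_integral_def H_def)
    also have "\<dots> = c q * (LINT y|lborel. H q (c q * y))"
      using lborel_integral_real_affine[of "c q" "H q" 0] c(1)[OF q] by simp
    also have "(LINT y|lborel. H q (c q * y)) = (LINT y|lborel. K q y) / q"
      using q by (simp add: K_def)
    also have "q powr (-1 + 1 / real m) = c q / q"
      using q powr_add[of q "-1" "1 / real m"] by (simp add: c_def powr_minus divide_inverse mult.commute)
    ultimately show ?thesis using q c(1)[OF q] by simp
  qed
  obtain \<gamma> where \<gamma>: "\<gamma> > 0" "\<And>x. x \<in> {0..\<epsilon>} \<Longrightarrow> G x \<ge> \<gamma>" using G_lower_bound by blast
  define d where "d y = indicator {0..1} y + (1 / \<gamma>) * (indicator {1..} y * (1 / y\<^sup>2))" for y :: real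
  have d: "integrable lborel d"
    unfolding d_def by (intro Bochner_Integration.integrable_add integrable_mult_right integrable_inverse_square_tail) simp
  have K_le: "0 \<le> K q y" "K q y \<le> d y" if q: "q > 0" for q y
  proof -
    show "0 \<le> K q y"
    proof (cases "c q * y \<in> {0..\<epsilon>}")
      case True
      then have "y \<ge> 0" using c(1)[OF q] by (simp add: zero_le_mult_iff)
      then show ?thesis using True G_pos[OF True] by (simp add: K_eq[OF q])
    qed (simp add: K_eq[OF q])
    show "K q y \<le> d y"
    proof (cases "c q * y \<in> {0..\<epsilon>}")
      case True
      then have y: "y \<ge> 0" using c(1)[OF q] by (simp add: zero_le_mult_iff)
      have G: "G (c q * y) \<ge> \<gamma>" using \<gamma>(2)[OF True] .
      show ?thesis
      proof (cases "y \<le> 1")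
        case True
        have "1 / (y ^ m * G (c q * y) + 1) \<le> 1"
          using y G \<gamma>(1) by (simp add: add_nonneg_pos)
        then have "K q y \<le> 1" by (auto simp: K_eq[OF q] indicator_def)
        also have "\<dots> \<le> d y" using True y \<gamma>(1) by (simp add: d_def)
        finally show ?thesis .
      next
        case False
        have "\<gamma> * y\<^sup>2 \<le> y ^ m * G (c q * y)"
          unfolding mult.commute[of \<gamma>]
          using False m G \<gamma>(1) by (intro mult_mono power_increasing) auto
        moreover have "0 < \<gamma> * y\<^sup>2" using False \<gamma>(1) by simp
        ultimately have "1 / (y ^ m * G (c q * y) + 1) \<le> 1 / (\<gamma> * y\<^sup>2)"
          by (intro frac_le) linarith+
        then show ?thesis using False \<open>c q * y \<in> {0..\<epsilon>}\<close> by (simp add: K_eq[OF q] d_def)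
      qed
    qed (use \<gamma>(1) in \<open>simp add: K_eq[OF q] d_def\<close>)
  qed
  have K0_meas [measurable]: "K0 \<in> borel_measurable borel" unfolding K0_def by measurable
  have K_lim: "(\<lambda>n. K (s n) y) \<longlonglongrightarrow> K0 y" if s: "\<And>n. s n > 0" "s \<longlonglongrightarrow> 0" for s y
  proof (cases "y \<ge> 0")
    case True
    have "(\<lambda>n. c (s n)) \<longlonglongrightarrow> 0 powr (1 / real m)"
      unfolding c_def using s m by (intro tendsto_powr') (auto simp: less_imp_le)
    then have lim: "(\<lambda>n. c (s n) * y) \<longlonglongrightarrow> 0"
      by (intro tendsto_mult_left_zero) simp
    have "\<forall>\<^sub>F n in sequentially. c (s n) * y < \<epsilon>"
      using order_tendstoD(2)[OF lim \<epsilon>] .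
    then have ev: "\<forall>\<^sub>F n in sequentially. c (s n) * y \<in> {0..\<epsilon>}"
      by eventually_elim (use True c(1)[OF s(1)] in \<open>auto simp: less_imp_le\<close>)
    have "(\<lambda>n. G (c (s n) * y)) \<longlonglongrightarrow> G 0"
      by (rule continuous_on_tendsto_compose[OF G_cont lim _ ev]) (use \<epsilon> in simp)
    then have "(\<lambda>n. 1 / (y ^ m * G (c (s n) * y) + 1)) \<longlonglongrightarrow> 1 / (y ^ m * G 0 + 1)"
      using True G_pos[of 0] \<epsilon> by (intro tendsto_intros) (auto simp: add_nonneg_eq_0_iff)
    then have "(\<lambda>n. 1 / (y ^ m * G (c (s n) * y) + 1)) \<longlonglongrightarrow> K0 y"
      using True by (simp add: K0_def)
    then show ?thesis
      by (rule Lim_transform_eventually) (use ev in eventually_elim, simp add: K_eq[OF s(1)])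
  next
    case False
    then have "K (s n) y = K0 y" for n
      using c(1)[OF s(1)[of n]] by (simp add: K_eq[OF s(1)] K0_def indicator_def zero_le_mult_iff)
    then show ?thesis by simp
  qed
  have K_int_lim: "(\<lambda>n. LINT y|lborel. K (s n) y) \<longlonglongrightarrow> (LINT y|lborel. K0 y)"
    if s: "\<And>n. s n > 0" "s \<longlonglongrightarrow> 0" for s
  proof (rule integral_dominated_convergence[OF _ _ d])
    show "K (s n) \<in> borel_measurable lborel" for n
      unfolding K_def using measurable_compose[OF _ H_meas[OF s(1)[of n]], of "\<lambda>y. c (s n) * y" borel] by simp
  qed (use K_lim[OF s] K_le s(1) in auto)
  have "((\<lambda>q. LINT y|lborel. K q y) \<longlongrightarrow> (LINT y|lborel. K0 y)) (at_right 0)"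
    unfolding tendsto_at_iff_sequentially comp_def using K_int_lim by auto
  then have "((\<lambda>q. (LINT x:{0..\<epsilon>}|lborel. 1 / (x ^ m * G x + q)) / q powr (-1 + 1 / real m))
      \<longlongrightarrow> (LINT y|lborel. K0 y)) (at_right 0)"
    by (rule Lim_transform_eventually) (use scaled in \<open>auto simp: eventually_at_filter\<close>)
  moreover have "(LINT y|lborel. K0 y) > 0"
  proof -
    have G0: "G 0 > 0" using G_pos \<epsilon> by simp
    \<comment> \<open>The bounds on \<open>K q\<close> pass to \<open>K0\<close> along any sequence of positive \<open>q\<close> tending to \<open>0\<close>.\<close>
    define s where "s n = inverse (real (Suc n))" for n
    have s: "s n > 0" "s \<longlonglongrightarrow> 0" for n
      unfolding s_def by (simp, rule LIMSEQ_inverse_real_of_nat)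
    have K0_le: "0 \<le> K0 y \<and> K0 y \<le> d y" for y
      using LIMSEQ_le_const[OF K_lim[OF s]] LIMSEQ_le_const2[OF K_lim[OF s]] K_le[OF s(1)] by blast
    have K0_int: "integrable lborel K0"
      by (rule Bochner_Integration.integrable_bound[OF d]) (use K0_le in \<open>auto intro: order_trans[OF _ abs_ge_self]\<close>)
    have "0 < 1 / (G 0 + 1)" using G0 by simp
    also have "\<dots> = (LINT y|lborel. indicator {0..1::real} y * (1 / (G 0 + 1)))"
      by simp
    also have "\<dots> \<le> (LINT y|lborel. K0 y)"
    proof (rule integral_mono)
      fix y :: real
      show "indicator {0..1} y * (1 / (G 0 + 1)) \<le> K0 y"
      proof (cases "y \<in> {0..1}")
        case True
        then have "y ^ m * G 0 \<le> 1 * G 0"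
          using G0 by (intro mult_right_mono power_le_one) auto
        moreover have "0 \<le> y ^ m * G 0"
          using True G0 by simp
        ultimately have "1 / (G 0 + 1) \<le> 1 / (y ^ m * G 0 + 1)"
          by (intro frac_le) linarith+
        then show ?thesis using True by (simp add: K0_def)
      qed (use K0_le in simp)
    qed (use K0_int in auto)
    finally show ?thesis .
  qed
  ultimately show ?thesis using that by blast
qed

text \<open>
  Replacing \<open>G x\<close> by \<open>G 0\<close> changes the denominator by \<open>x\<^sup>2 * G2 x\<close>, while the product of the two
  denominators is at least a positive multiple of \<open>x\<^sup>2\<close>. So the two integrals differ by at most a constant \<open>M\<close>
  that does not depend on \<open>q\<close>, and \<open>M\<close> is negligible against \<open>- ln q\<close>.
\<close>

theorem integral_asymptotics_log:
  assumes G2: "continuous_on {0..\<epsilon>} G2" "\<And>x. x \<in> {0..\<epsilon>} \<Longrightarrow> G x = G 0 + x * G2 x"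
  shows "((\<lambda>q. (LINT x:{0..\<epsilon>}|lborel. 1 / (x * G x + q)) / - ln q) \<longlongrightarrow> 1 / G 0) (at_right 0)"
proof -
  define A where "A = G 0"
  have A: "A > 0" using G_pos \<epsilon> by (simp add: A_def)
  obtain \<gamma> where \<gamma>: "\<gamma> > 0" "\<And>x. x \<in> {0..\<epsilon>} \<Longrightarrow> G x \<ge> \<gamma>" using G_lower_bound by blast
  have "bounded (G2 ` {0..\<epsilon>})"
    by (intro compact_imp_bounded compact_continuous_image G2) simp
  then obtain B where B: "B > 0" "\<And>x. x \<in> {0..\<epsilon>} \<Longrightarrow> \<bar>G2 x\<bar> \<le> B"
    unfolding bounded_pos by auto
  define M where "M = B / (\<gamma> * A) * \<epsilon>"
  let ?I = "\<lambda>q. LINT x:{0..\<epsilon>}|lborel. 1 / (x * G x + q)"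
  let ?J = "\<lambda>q. (ln (A * \<epsilon> + q) - ln q) / A"
  have diff: "\<bar>?I q - ?J q\<bar> \<le> M" if q: "q > 0" for q
  proof -
    have den: "A * x + q > 0" if "x \<in> {0..\<epsilon>}" for x
      using that A q by (intro add_nonneg_pos) auto
    have "(LBINT x. 1 / (A * x + q) * indicator {0..\<epsilon>} x) = ln (A * \<epsilon> + q) / A - ln (A * 0 + q) / A"
    proof (rule integral_FTC_Icc_real)
      fix x assume x: "0 \<le> x" "x \<le> \<epsilon>"
      then have "A * x + q > 0" using den by simp
      then show "((\<lambda>x. ln (A * x + q) / A) has_real_derivative 1 / (A * x + q)) (at x)"
        "isCont (\<lambda>x. 1 / (A * x + q)) x"
        using A by (auto intro!: derivative_eq_intros continuous_intros)
    qed (use \<epsilon> in simp)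
    then have J: "(LINT x:{0..\<epsilon>}|lborel. 1 / (A * x + q)) = ?J q"
      by (simp add: set_lebesgue_integral_def mult.commute diff_divide_distrib)
    have cont: "continuous_on {0..\<epsilon>} (\<lambda>x. 1 / (x * G x + q))" "continuous_on {0..\<epsilon>} (\<lambda>x. 1 / (A * x + q))"
      using integrand_continuous[OF q, of 1] den
      by (simp, intro continuous_intros ballI) (metis less_irrefl)
    have set_int: "set_integrable lborel {0..\<epsilon>} (\<lambda>x. 1 / (x * G x + q))"
      "set_integrable lborel {0..\<epsilon>} (\<lambda>x. 1 / (A * x + q))"
      using borel_integrable_atLeastAtMost' cont by blast+
    have "?I q - ?J q = (LINT x:{0..\<epsilon>}|lborel. 1 / (x * G x + q) - 1 / (A * x + q))"
      unfolding J[symmetric] by (rule set_integral_diff(2)[OF set_int, symmetric])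
    also have "\<bar>\<dots>\<bar> \<le> (LINT x:{0..\<epsilon>}|lborel. B / (\<gamma> * A))"
      unfolding set_lebesgue_integral_def real_norm_def[symmetric]
    proof (rule Bochner_Integration.integral_norm_bound_integral)
      show "integrable lborel (\<lambda>x. indicator {0..\<epsilon>} x *\<^sub>R (1 / (x * G x + q) - 1 / (A * x + q)))"
        using set_integral_diff(1)[OF set_int] by (simp add: set_integrable_def)
      fix x :: real
      show "norm (indicator {0..\<epsilon>} x *\<^sub>R (1 / (x * G x + q) - 1 / (A * x + q))) \<le>
          indicator {0..\<epsilon>} x *\<^sub>R (B / (\<gamma> * A))"
      proof (cases "x \<in> {0..\<epsilon>}")
        case x: True
        have pos: "x * G x + q > 0" "A * x + q > 0"
          using denominator_pos[OF q x, of 1] den[OF x] by simp_all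
        have "\<bar>1 / (x * G x + q) - 1 / (A * x + q)\<bar> \<le> B / (\<gamma> * A)"
        proof (cases "x = 0")
          case True
          then show ?thesis using B \<gamma> A by simp
        next
          case False
          then have x0: "x > 0" using x by simp
          have "1 / (x * G x + q) - 1 / (A * x + q) = - (x\<^sup>2 * G2 x) / ((x * G x + q) * (A * x + q))"
            using pos G2(2)[OF x] by (simp add: A_def field_simps power2_eq_square)
          also have "\<bar>\<dots>\<bar> = (x\<^sup>2 * \<bar>G2 x\<bar>) / ((x * G x + q) * (A * x + q))"
            using pos by (simp add: abs_mult)
          also have "\<dots> \<le> (x\<^sup>2 * B) / ((x * \<gamma>) * (A * x))"
          proof (intro frac_le mult_left_mono mult_mono)
            show "x * \<gamma> \<le> x * G x + q"
              using \<gamma>(2)[OF x] x0 q by (intro order_trans[OF mult_left_mono[of \<gamma> "G x" x]]) auto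
          qed (use B x x0 A \<gamma> q pos in auto)
          also have "\<dots> = B / (\<gamma> * A)"
            using x0 by (simp add: power2_eq_square)
          finally show ?thesis .
        qed
        then show ?thesis using x by simp
      qed simp
    qed (use borel_integrable_atLeastAtMost'[of 0 \<epsilon> "\<lambda>_. B / (\<gamma> * A)"] in \<open>simp add: set_integrable_def\<close>)
    also have "\<dots> = M"
      using \<epsilon> by (simp add: M_def set_lebesgue_integral_def)
    finally show ?thesis .
  qed
  have "((\<lambda>q. ?J q / - ln q) \<longlongrightarrow> inverse A) (at_right 0)"
    using A \<epsilon> by real_asymp
  moreover have "((\<lambda>q. (?I q - ?J q) / - ln q) \<longlongrightarrow> 0) (at_right 0)"
  proof (rule Lim_null_comparison)
    have "\<forall>\<^sub>F q :: real in at_right 0. q \<in> {0<..<1}"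
      by (intro eventually_at_right_real) simp
    then show "\<forall>\<^sub>F q in at_right 0. norm ((?I q - ?J q) / - ln q) \<le> M / - ln q"
    proof eventually_elim
      case (elim q)
      then have ln: "ln q < 0" by simp
      then have "norm ((?I q - ?J q) / - ln q) = \<bar>?I q - ?J q\<bar> / - ln q"
        unfolding real_norm_def abs_divide by simp
      also have "\<dots> \<le> M / - ln q"
        using elim ln by (intro divide_right_mono diff) auto
      finally show ?case .
    qed
    show "((\<lambda>q. M / - ln q) \<longlongrightarrow> 0) (at_right 0)" by real_asymp
  qed
  ultimately have "((\<lambda>q. ?J q / - ln q + (?I q - ?J q) / - ln q) \<longlongrightarrow> inverse A + 0) (at_right 0)"
    by (rule tendsto_add)
  then show ?thesis by (simp add: A_def diff_divide_distrib inverse_eq_divide)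
qed

end
section \<open>The order of vanishing of the potential\<close>

lemma powser_factor:
  fixes a :: "nat \<Rightarrow> real"
  assumes m: "m \<ge> 1" "\<And>n. n \<in> {1..m - 1} \<Longrightarrow> a n = 0"
    and sm: "summable (\<lambda>n. a (Suc n) * x ^ Suc n)"
  shows "summable (\<lambda>n. a (n + m) * x ^ n)"
    and "(\<Sum>n. a (Suc n) * x ^ Suc n) = x ^ m * (\<Sum>n. a (n + m) * x ^ n)"
proof -
  show sm': "summable (\<lambda>n. a (n + m) * x ^ n)"
  proof (cases "x = 0")
    case False
    have "summable (\<lambda>n. a (Suc (n + (m - 1))) * x ^ Suc (n + (m - 1)))"
      using sm by (rule summable_ignore_initial_segment)
    then have "summable (\<lambda>n. a (n + m) * x ^ (n + m))"
      using m(1) by (simp del: power_Suc)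
    then have "summable (\<lambda>n. a (n + m) * x ^ (n + m) / x ^ m)"
      by (rule summable_divide)
    then show ?thesis using False by (simp add: power_add)
  qed (simp add: power_0_left if_distrib cong: if_cong)
  have "(\<Sum>n. a (Suc n) * x ^ Suc n) =
      (\<Sum>n. a (Suc (n + (m - 1))) * x ^ Suc (n + (m - 1))) + (\<Sum>i<m - 1. a (Suc i) * x ^ Suc i)"
    by (rule suminf_split_initial_segment[OF sm])
  also have "(\<Sum>i<m - 1. a (Suc i) * x ^ Suc i) = 0"
    using m by (intro sum.neutral) auto
  also have "(\<Sum>n. a (Suc (n + (m - 1))) * x ^ Suc (n + (m - 1))) = (\<Sum>n. x ^ m * (a (n + m) * x ^ n))"
    using m(1) by (simp add: power_add mult_ac del: power_Suc)
  also have "\<dots> = x ^ m * (\<Sum>n. a (n + m) * x ^ n)"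
    by (rule suminf_mult[OF sm'])
  finally show "(\<Sum>n. a (Suc n) * x ^ Suc n) = x ^ m * (\<Sum>n. a (n + m) * x ^ n)" by simp
qed

text \<open>
  With \<open>m\<close> the index of the first nonzero coefficient, \<open>G\<close> is the power series divided by \<open>x ^ m\<close>, and
  \<open>G2\<close> is the next quotient \<open>(G x - G 0) / x\<close>; Abel's theorem makes both continuous. The sign of \<open>a m\<close> is
  not given: \<open>G 0 = a m\<close> is nonnegative as a limit of positive values, and it is nonzero.
\<close>

lemma powser_quotient_properties:
  fixes a :: "nat \<Rightarrow> real"
  assumes \<epsilon>: "\<epsilon> > 0"
    and sm: "\<And>x. x \<in> {0..\<epsilon>} \<Longrightarrow> summable (\<lambda>n. a (Suc n) * x ^ Suc n)"
    and pos: "\<And>x. x \<in> {0<..\<epsilon>} \<Longrightarrow> (\<Sum>n. a (Suc n) * x ^ Suc n) > 0"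
    and m: "m \<ge> 1" "\<And>n. n \<in> {1..m - 1} \<Longrightarrow> a n = 0" "a m \<noteq> 0"
  obtains G G2 where
    "continuous_on {0..\<epsilon>} G" "\<And>x. x \<in> {0..\<epsilon>} \<Longrightarrow> G x > 0"
    "continuous_on {0..\<epsilon>} G2" "\<And>x. x \<in> {0..\<epsilon>} \<Longrightarrow> G x = G 0 + x * G2 x"
    "\<And>x. x \<in> {0..\<epsilon>} \<Longrightarrow> (\<Sum>n. a (Suc n) * x ^ Suc n) = x ^ m * G x"
proof -
  define G where "G x = (\<Sum>n. a (n + m) * x ^ n)" for x
  define G2 where "G2 x = (\<Sum>n. a (Suc n + m) * x ^ n)" for x
  have factor: "summable (\<lambda>n. a (n + m) * x ^ n)"
      "(\<Sum>n. a (Suc n) * x ^ Suc n) = x ^ m * (\<Sum>n. a (n + m) * x ^ n)" if "x \<in> {0..\<epsilon>}" for x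
    using powser_factor[of m a x, OF m(1) m(2) sm[OF that]] by blast+
  have cont: "continuous_on {0..\<epsilon>} G"
    unfolding G_def using \<epsilon> factor(1)[of \<epsilon>] by (intro Abel_continuous_on_powser) auto
  have G0: "G 0 = a m" unfolding G_def by simp
  have cont2: "continuous_on {0..\<epsilon>} G2"
    unfolding G2_def using \<epsilon> powser_split_head(3)[OF factor(1)[of \<epsilon>]] by (intro Abel_continuous_on_powser) auto
  have eq: "(\<Sum>n. a (Suc n) * x ^ Suc n) = x ^ m * G x" if "x \<in> {0..\<epsilon>}" for x
    using factor(2)[OF that] by (simp only: G_def)
  have pos': "G x > 0" if "x \<in> {0<..\<epsilon>}" for x
    using pos[OF that] eq[of x] that by (auto simp: zero_less_mult_iff)
  have "G 0 \<ge> 0"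
  proof (rule continuous_ge_on_closure[where f = G and S = "{0<..<\<epsilon>}" and x = 0 and a = 0])
    show "continuous_on (closure {0<..<\<epsilon>}) G" "0 \<in> closure {0<..<\<epsilon>}" using cont \<epsilon> by simp_all
  qed (use pos' in \<open>auto simp: less_imp_le\<close>)
  then have "G 0 > 0" using G0 m(3) by simp
  then have "G x > 0" if "x \<in> {0..\<epsilon>}" for x
    using pos'[of x] that by (cases "x = 0") auto
  moreover have "G x = G 0 + x * G2 x" if "x \<in> {0..\<epsilon>}" for x
    using powser_split_head(1)[OF factor(1)[OF that]] G0 by (simp add: G_def G2_def mult.commute)
  ultimately show ?thesis using that cont cont2 eq by blast
qed

lemma powser_indicator_measurable:
  fixes b :: "nat \<Rightarrow> real"
  assumes "X \<in> sets borel" "\<And>x. x \<in> X \<Longrightarrow> summable (\<lambda>n. b n * x ^ Suc n)"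
    and f: "\<And>x. x \<in> X \<Longrightarrow> f x = - (\<Sum>n. b n * x ^ Suc n)"
  shows "(\<lambda>x. indicator X x * (f x + p)) \<in> borel_measurable borel"
proof (rule borel_measurable_LIMSEQ_real)
  show "(\<lambda>n. indicator X x * (- (\<Sum>i<n. b i * x ^ Suc i) + p)) \<longlonglongrightarrow> indicator X x * (f x + p)" for x
  proof (cases "x \<in> X")
    case True
    show ?thesis
      unfolding f[OF True] by (intro tendsto_intros summable_LIMSEQ assms(2)[OF True])
  qed simp
  show "(\<lambda>x. indicator X x * (- (\<Sum>i<n. b i * x ^ Suc i) + p)) \<in> borel_measurable borel" for n
    using assms(1) by measurable
qed

section \<open>Sharp order of the quadratic form of the limit covariance\<close>

theorem theorem3p2:
  fixes X :: "real set" and \<sigma> \<epsilon> :: real and f :: "real \<Rightarrow> real"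
    and a :: "nat \<Rightarrow> real" and m :: nat and g :: L2
  assumes "connected X" and "interior X \<noteq> {}"
    and "\<sigma> > 0" and "\<epsilon> > 0" and "{0..\<epsilon>} \<subseteq> X"
    and "\<And>x. x \<in> X \<Longrightarrow> summable (\<lambda>n. a (Suc n) * x ^ Suc n)"
    and "\<And>x. x \<in> X \<Longrightarrow> f x = - (\<Sum>n. a (Suc n) * x ^ Suc n)"
    and "f 0 = 0"
    and "\<And>x. x \<in> X - {0} \<Longrightarrow> f x < 0"
    and "\<And>p. p < 0 \<Longrightarrow> set_integrable lborel X (\<lambda>x. 1 / \<bar>f x + p\<bar>)"
    and "m \<ge> 1" and "\<And>n. n \<in> {1..m - 1} \<Longrightarrow> a n = 0" and "a m \<noteq> 0"
    and "g = abs_L2 (indicator {0..\<epsilon>})"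
  shows "(m = 1 \<longrightarrow>
            Theta_left0 (\<lambda>p. inner (cov_inf X (\<lambda>x. f x + p) \<sigma> id g) g)
                        (\<lambda>p. - ln (- p))) \<and>
         (m > 1 \<longrightarrow>
            Theta_left0 (\<lambda>p. inner (cov_inf X (\<lambda>x. f x + p) \<sigma> id g) g)
                        (\<lambda>p. (- p) powr (- 1 + 1 / real m)))"
proof -
  have X: "X \<in> sets borel"
    using assms(1) by (intro real_interval_borel_measurable) (simp add: is_interval_connected_1)
  have inX: "x \<in> X" if "x \<in> {0..\<epsilon>}" for x using that assms(5) by blast
  have pos: "(\<Sum>n. a (Suc n) * x ^ Suc n) > 0" if "x \<in> {0<..\<epsilon>}" for x
  proof -
    have "x \<in> X - {0}" using inX[of x] that by simp
    then show ?thesis using assms(7)[of x] assms(9)[of x] by (simp del: power_Suc)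
  qed
  obtain G G2 where G: "continuous_on {0..\<epsilon>} G" "\<And>x. x \<in> {0..\<epsilon>} \<Longrightarrow> G x > 0"
    and G2: "continuous_on {0..\<epsilon>} G2" "\<And>x. x \<in> {0..\<epsilon>} \<Longrightarrow> G x = G 0 + x * G2 x"
    and eq: "\<And>x. x \<in> {0..\<epsilon>} \<Longrightarrow> (\<Sum>n. a (Suc n) * x ^ Suc n) = x ^ m * G x"
    using powser_quotient_properties[of \<epsilon> a m, OF assms(4) assms(6)[OF inX] pos assms(11) assms(12) assms(13)]
    by blast
  have f_eq: "f x = - (x ^ m * G x)" if "x \<in> {0..\<epsilon>}" for x
    unfolding assms(7)[OF inX[OF that]] eq[OF that] ..
  have f_nonpos: "f x \<le> 0" if "x \<in> X" for x
    using assms(8) assms(9)[of x] that by (cases "x = 0") auto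
  let ?I = "\<lambda>q. LINT x:{0..\<epsilon>}|lborel. 1 / (x ^ m * G x + q)"
  have quadratic_form: "inner (cov_inf X (\<lambda>x. f x + p) \<sigma> id g) g = \<sigma>\<^sup>2 / 2 * ?I (- p)"
    if p: "p < 0" for p
  proof -
    let ?u = "indicator {0..\<epsilon>} :: real \<Rightarrow> real"
    let ?k = "\<lambda>x. indicator X x * (f x + p)"
    have u: "square_integrable ?u"
    proof -
      have "(\<lambda>x. (?u x)\<^sup>2) = ?u" by (simp add: fun_eq_iff indicator_def)
      moreover have "integrable lborel ?u"
        using assms(4) by (intro integrable_real_indicator) auto
      ultimately show ?thesis by (simp add: square_integrable_def)
    qed
    have uX: "abs_L2 ?u \<in> L2_on X"
      using inX by (auto simp: abs_L2_in_L2_on[OF u] indicator_def)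
    have k: "?k \<in> borel_measurable borel"
      by (rule powser_indicator_measurable[OF X assms(6,7)])
    have h: "f x + p \<le> 0" "f x + p \<le> p" if "x \<in> X" for x using f_nonpos[OF that] p by auto
    have V: "square_integrable (\<lambda>x. \<sigma>\<^sup>2 / (2 * \<bar>?k x\<bar>) * ?u x)"
      "cov_inf X (\<lambda>x. f x + p) \<sigma> id (abs_L2 ?u) = abs_L2 (\<lambda>x. \<sigma>\<^sup>2 / (2 * \<bar>?k x\<bar>) * ?u x)"
      by (rule cov_inf_eq[OF k _ _ p u uX]; rule h; assumption)+
    have "inner (cov_inf X (\<lambda>x. f x + p) \<sigma> id g) g =
        (LINT x|lborel. (\<sigma>\<^sup>2 / (2 * \<bar>?k x\<bar>) * ?u x) * ?u x)"
      unfolding assms(14) V(2) by (rule inner_abs_L2[OF V(1) u])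
    also have "\<dots> = (LINT x|lborel. \<sigma>\<^sup>2 / 2 * (?u x *\<^sub>R (1 / (x ^ m * G x + - p))))"
    proof (rule Bochner_Integration.integral_cong[OF refl])
      fix x
      show "(\<sigma>\<^sup>2 / (2 * \<bar>?k x\<bar>) * ?u x) * ?u x = \<sigma>\<^sup>2 / 2 * (?u x *\<^sub>R (1 / (x ^ m * G x + - p)))"
      proof (cases "x \<in> {0..\<epsilon>}")
        case True
        then have "\<bar>?k x\<bar> = x ^ m * G x + - p"
          using h(1)[OF inX[OF True]] inX[OF True] f_eq[OF True] by simp
        then show ?thesis using True by simp
      qed simp
    qed
    also have "\<dots> = \<sigma>\<^sup>2 / 2 * ?I (- p)"
      unfolding set_lebesgue_integral_def by (rule integral_mult_right_zero)
    finally show ?thesis .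
  qed
  have Theta: "Theta_left0 (\<lambda>p. inner (cov_inf X (\<lambda>x. f x + p) \<sigma> id g) g) (\<lambda>p. b (- p))"
    if b: "\<forall>\<^sub>F q in at_right 0. b q > 0" and L: "L > 0" "((\<lambda>q. ?I q / b q) \<longlongrightarrow> L) (at_right 0)"
    for b L
  proof (rule Theta_left0I)
    show "\<forall>\<^sub>F p in at_left 0. b (- p) > 0"
      using b by (simp add: eventually_at_left_to_right)
    show "\<sigma>\<^sup>2 / 2 * L > 0" using L(1) assms(3) by simp
    have "((\<lambda>q. \<sigma>\<^sup>2 / 2 * (?I q / b q)) \<longlongrightarrow> \<sigma>\<^sup>2 / 2 * L) (at_right 0)"
      by (rule tendsto_mult_left[OF L(2)])
    then have "((\<lambda>p. \<sigma>\<^sup>2 / 2 * (?I (- p) / b (- p))) \<longlongrightarrow> \<sigma>\<^sup>2 / 2 * L) (at_left 0)"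
      by (simp add: filterlim_at_left_to_right)
    then show "((\<lambda>p. inner (cov_inf X (\<lambda>x. f x + p) \<sigma> id g) g / b (- p)) \<longlongrightarrow> \<sigma>\<^sup>2 / 2 * L) (at_left 0)"
    proof (rule Lim_transform_eventually)
      show "\<forall>\<^sub>F p in at_left 0. \<sigma>\<^sup>2 / 2 * (?I (- p) / b (- p)) =
          inner (cov_inf X (\<lambda>x. f x + p) \<sigma> id g) g / b (- p)"
        unfolding eventually_at_filter
      proof (intro always_eventually allI impI)
        fix p :: real assume "p \<in> {..<0}"
        then show "\<sigma>\<^sup>2 / 2 * (?I (- p) / b (- p)) = inner (cov_inf X (\<lambda>x. f x + p) \<sigma> id g) g / b (- p)"
          by (subst quadratic_form) (simp_all only: lessThan_iff times_divide_eq_right)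
      qed
    qed
  qed
  show ?thesis
  proof (intro conjI impI)
    assume m: "m = 1"
    show "Theta_left0 (\<lambda>p. inner (cov_inf X (\<lambda>x. f x + p) \<sigma> id g) g) (\<lambda>p. - ln (- p))"
    proof (rule Theta[where b = "\<lambda>q. - ln q"])
      show "\<forall>\<^sub>F q in at_right 0. - ln q > (0 :: real)" by real_asymp
      show "1 / G 0 > 0" using G(2) assms(4) by simp
      show "((\<lambda>q. ?I q / - ln q) \<longlongrightarrow> 1 / G 0) (at_right 0)"
        using integral_asymptotics_log[OF assms(4) G G2] m by simp
    qed
  next
    assume m: "m > 1"
    then obtain L where "L > 0"
        "((\<lambda>q. ?I q / q powr (-1 + 1 / real m)) \<longlongrightarrow> L) (at_right 0)"
      using integral_asymptotics_power[OF assms(4) G, of m] by auto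
    then show "Theta_left0 (\<lambda>p. inner (cov_inf X (\<lambda>x. f x + p) \<sigma> id g) g)
        (\<lambda>p. (- p) powr (- 1 + 1 / real m))"
      by (intro Theta[where b = "\<lambda>q. q powr (- 1 + 1 / real m)"]) (auto simp: eventually_at_filter)
  qed
qed

end
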